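(* $\mathfrak{N}$ is an ideal of the Lie algebra $\mathcal{H}$.
   Context: Let $\mathbb{F}$ be a field of characteristic $p>3$, and let $m>1$, $n>3$ be integers. Put $Y_0=\{1,\dots,2m\}$, $Y_1=\{2m+1,\dots,2m+n\}$, $Y=Y_0\cup Y_1$. Fix $\underline t=(t_1,\dots,t_{2m})$ with positive integer entries, $\pi_i=p^{t_i}-1$, $\pi=(\pi_1,\dots,\pi_{2m})$, $\mathbb{A}=\{\alpha\in\mathbb{N}_0^{2m}:\alpha_i\le\pi_i\}$, $|\alpha|=\sum\alpha_i$; $\varepsilon_i$ is the $i$-th unit vector. $\mathbb{B}_k$ is the set of strictly increasing $k$-tuples $u=\langle i_1,\dots,i_k\rangle$ in $Y_1$ (also viewed as subsets), $|u|=k$, $\mathbb{B}=\bigcup_{k=0}^n\mathbb{B}_k$, $\mathbb{B}^0=\{u\in\mathbb{B}: |u|\text{ even}\}$, $x^u=x_{i_1}\cdots x_{i_k}$, $x^{\emptyset}=1$, $\omega=\langle 2m+1,\dots,2m+n\rangle$ (so $|\omega|=n$). $\mathcal{O}=\mathcal{O}(2m,n;\underline t)$ is the associative superalgebra with basis $\{x^{(\alpha)}x^u:\alpha\in\mathbb{A},u\in\mathbb{B}\}$ and products $x^{(\alpha)}x^{(\beta)}=\prod_i\binom{\alpha_i+\beta_i}{\alpha_i}x^{(\alpha+\beta)}$ (zero if $\alpha+\beta\notin\mathbb{A}$), $x_kx_l=-x_lx_k$, $x_k^2=0$ for $k,l\in Y_1$, $x^{(\alpha)}x_k=x_kx^{(\alpha)}$;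 write $x_i=x^{(\varepsilon_i)}$ for $i\in Y_0$. The parity of $x^{(\alpha)}x^u$ is $|u|$ mod 2 and its $\mathbb{Z}$-degree is $|\alpha|+|u|$. The superderivations $\partial_i$ ($i\in Y$) are $\partial_i(x^{(\alpha)}x^u)=x^{(\alpha-\varepsilon_i)}x^u$ for $i\in Y_0$ (zero if $\alpha_i=0$), and $\partial_i(x^{(\alpha)}x^u)=x^{(\alpha)}\,\partial x^u/\partial x_i$ (left derivative) for $i\in Y_1$; $\mu(i)=\overline 0$ for $i\in Y_0$, $\mu(i)=\overline 1$ for $i\in Y_1$ is the parity of $\partial_i$. $W=\{\sum_{i\in Y}a_i\partial_i: a_i\in\mathcal{O}\}$ is the generalized Witt Lie superalgebra, with bracket $[a\partial_i,b\partial_j]=a\partial_i(b)\partial_j-(-1)^{\mathrm p(a\partial_i)\mathrm p(b\partial_j)}b\partial_j(a)\partial_i$. For $i\in Y_0$: $i'=i+m$, $\tau(i)=1$ if $i\le m$; $i'=i-m$, $\tau(i)=-1$ if $m<i\le 2m$; for $i\in Y_1$: $i'=i$, $\tau(i)=1$. Define the linear map $\mathrm{D_H}:\mathcal{O}\to W$ by $\mathrm{D_H}(a)=\sum_{i\in Y}\tau(i)(-1)^{\mu(i)\mathrm p(a)}\partial_i(a)\partial_{i'}$ for homogeneous $a$. The even part of the Hamiltonian superalgebra is the Lie algebra $$\mathcal{H}=\mathrm{span}_{\mathbb{F}}\{\mathrm{D_H}(x^{(\alpha)}x^u):\alpha\in\mathbb{A},u\in\mathbb{B}^0,(\alpha,u)\ne(\pi,\omega)\},$$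 and $$\mathfrak{N}=\mathrm{span}_{\mathbb{F}}\{\mathrm{D_H}(x^{(\alpha)}x^u):\alpha\in\mathbb{A},u\in\mathbb{B}^0,(\alpha,u)\ne(\pi,\omega),(\alpha,u)\ne(\pi,\emptyset)\}.$$ *)

theory Defs
  imports "HOL-Library.Function_Algebras" "HOL-Computational_Algebra.Computational_Algebra"
begin

section \<open>Lie algebras and ideals\<close>

locale lie_algebra = vector_space scale
  for scale :: "'k::field \<Rightarrow> 'v::ab_group_add \<Rightarrow> 'v" +
  fixes L :: "'v set" and br :: "'v \<Rightarrow> 'v \<Rightarrow> 'v"
  assumes carrier_subspace: "subspace L"
    and br_closed: "x \<in> L \<Longrightarrow> y \<in> L \<Longrightarrow> br x y \<in> L"
    and br_add_left: "x \<in> L \<Longrightarrow> y \<in> L \<Longrightarrow> z \<in> L \<Longrightarrow> br (x + y) z = br x z + br y z"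
    and br_add_right: "x \<in> L \<Longrightarrow> y \<in> L \<Longrightarrow> z \<in> L \<Longrightarrow> br x (y + z) = br x y + br x z"
    and br_scale_left: "x \<in> L \<Longrightarrow> y \<in> L \<Longrightarrow> br (scale c x) y = scale c (br x y)"
    and br_scale_right: "x \<in> L \<Longrightarrow> y \<in> L \<Longrightarrow> br x (scale c y) = scale c (br x y)"
    and br_self: "x \<in> L \<Longrightarrow> br x x = 0"
    and jacobi: "x \<in> L \<Longrightarrow> y \<in> L \<Longrightarrow> z \<in> L \<Longrightarrow>
      br x (br y z) + br y (br z x) + br z (br x y) = 0"

locale lie_ideal = lie_algebra scale L br
  for scale :: "'k::field \<Rightarrow> 'v::ab_group_add \<Rightarrow> 'v" and L :: "'v set"
    and br :: "'v \<Rightarrow> 'v \<Rightarrow> 'v" +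
  fixes I :: "'v set"
  assumes ideal_subspace: "subspace I"
    and ideal_subset: "I \<subseteq> L"
    and ideal_br: "x \<in> L \<Longrightarrow> y \<in> I \<Longrightarrow> br x y \<in> I"

section \<open>The superalgebras\<close>

text \<open>
  A basis element \<open>x^(\<alpha>) x^u\<close> of the superalgebra \<open>\<O>\<close> is indexed by a pair \<open>(\<alpha>, u)\<close>, where the
  multi-index \<open>\<alpha>\<close> is a function vanishing outside \<open>Y0\<close> and the increasing tuple \<open>u\<close> is
  represented by its set of entries. Elements of \<open>\<O>\<close> are coefficient functions supported on
  the finite set of these indices. With the pointwise operations of
  \<^theory>\<open>HOL-Library.Function_Algebras\<close>, \<open>\<alpha> + \<beta>\<close> is the sum of multi-indices and \<open>f + g\<close> the
  sum in \<open>\<O>\<close>; the product of \<open>\<O>\<close> is \<open>omult\<close> below and not the pointwise product \<open>f * g\<close>.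

  The \<open>\<O>\<close>-module \<open>W\<close> is free on the derivations \<open>\<partial>\<^sub>i\<close> (an operator \<open>\<Sum>\<^sub>i a\<^sub>i \<partial>\<^sub>i\<close> sends \<open>x\<^sub>j\<close> to \<open>a\<^sub>j\<close>,
  see \<open>wact_gen\<close> below), so its element \<open>\<Sum>\<^sub>i a\<^sub>i \<partial>\<^sub>i\<close> is represented by the family \<open>i \<mapsto> a\<^sub>i\<close>, which
  is zero outside \<open>Y\<close>.
\<close>

type_synonym bidx = "(nat \<Rightarrow> nat) \<times> nat set"
type_synonym 'a oelt = "bidx \<Rightarrow> 'a"
type_synonym 'a welt = "nat \<Rightarrow> 'a oelt"

definition oscale :: "'a::field \<Rightarrow> 'a oelt \<Rightarrow> 'a oelt"
  where "oscale c f = (\<lambda>b. c * f b)"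

definition wscale :: "'a::field \<Rightarrow> 'a welt \<Rightarrow> 'a welt"
  where "wscale c D = (\<lambda>i. oscale c (D i))"

definition omono :: "(nat \<Rightarrow> nat) \<Rightarrow> nat set \<Rightarrow> 'a::field oelt"
  where "omono \<alpha> u = (\<lambda>b. if b = (\<alpha>, u) then 1 else 0)"

definition unit_idx :: "nat \<Rightarrow> nat \<Rightarrow> nat"
  where "unit_idx i = (\<lambda>k. if k = i then 1 else 0)"

definition opart :: "nat \<Rightarrow> 'a::field oelt \<Rightarrow> 'a oelt"
  \<comment> \<open>the homogeneous component of parity \<open>r \<in> {0, 1}\<close>\<close>
  where "opart r f = (\<lambda>(\<alpha>, u). if card u mod 2 = r then f (\<alpha>, u) else 0)"

definition wsingle :: "nat \<Rightarrow> 'a::field oelt \<Rightarrow> 'a welt"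
  \<comment> \<open>\<open>a \<partial>\<^sub>i\<close>\<close>
  where "wsingle i a = (\<lambda>k. if k = i then a else 0)"

locale superalgebra_params =
  fixes p m n :: nat and t :: "nat \<Rightarrow> nat"
begin

definition Y0 :: "nat set" where "Y0 = {1..2 * m}"
definition Y1 :: "nat set" where "Y1 = {2 * m + 1..2 * m + n}"
definition Y :: "nat set" where "Y = Y0 \<union> Y1"

definition top_idx :: "nat \<Rightarrow> nat"
  \<comment> \<open>the multi-index \<open>\<pi>\<close>\<close>
  where "top_idx i = (if i \<in> Y0 then p ^ t i - 1 else 0)"

definition idxA :: "(nat \<Rightarrow> nat) set"
  where "idxA = {\<alpha>. (\<forall>i\<in>Y0. \<alpha> i \<le> top_idx i) \<and> (\<forall>i. i \<notin> Y0 \<longrightarrow> \<alpha> i = 0)}"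

definition idxB :: "nat set set" where "idxB = Pow Y1"
definition idxB_even :: "nat set set" where "idxB_even = {u \<in> idxB. even (card u)}"

definition obasis :: "bidx set" where "obasis = idxA \<times> idxB"

definition osuper :: "'a::field oelt set"
  where "osuper = {f. \<forall>b. b \<notin> obasis \<longrightarrow> f b = 0}"

definition witt :: "'a::field welt set"
  where "witt = {D. (\<forall>i\<in>Y. D i \<in> osuper) \<and> (\<forall>i. i \<notin> Y \<longrightarrow> D i = 0)}"

text \<open>
  The sign counts the pairs \<open>(k, l) \<in> u \<times> v\<close> with \<open>l < k\<close>, i.e. the transpositions that sort the
  word \<open>x^u x^v\<close>.
\<close>

definition bmult :: "bidx \<Rightarrow> bidx \<Rightarrow> 'a::field oelt"
  where "bmult = (\<lambda>(\<alpha>, u) (\<beta>, v).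
    if \<alpha> + \<beta> \<in> idxA \<and> u \<inter> v = {}
    then oscale (of_nat (\<Prod>i\<in>Y0. (\<alpha> i + \<beta> i) choose \<alpha> i)
                 * (- 1) ^ card {(k, l). k \<in> u \<and> l \<in> v \<and> l < k})
           (omono (\<alpha> + \<beta>) (u \<union> v))
    else 0)"

definition omult :: "'a::field oelt \<Rightarrow> 'a oelt \<Rightarrow> 'a oelt"
  where "omult f g = (\<Sum>b\<in>obasis. \<Sum>c\<in>obasis. oscale (f b * g c) (bmult b c))"

definition bder :: "nat \<Rightarrow> bidx \<Rightarrow> 'a::field oelt"
  where "bder i = (\<lambda>(\<alpha>, u).
    if i \<in> Y0 then (if \<alpha> i = 0 then 0 else omono (\<alpha> - unit_idx i) u)
    else if i \<in> u then oscale ((- 1) ^ card {k \<in> u. k < i}) (omono \<alpha> (u - {i}))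
    else 0)"

definition oder :: "nat \<Rightarrow> 'a::field oelt \<Rightarrow> 'a oelt"
  where "oder i f = (\<Sum>b\<in>obasis. oscale (f b) (bder i b))"

definition mu :: "nat \<Rightarrow> nat" where "mu i = (if i \<in> Y1 then 1 else 0)"

definition conj_idx :: "nat \<Rightarrow> nat"
  \<comment> \<open>\<open>i \<mapsto> i'\<close>\<close>
  where "conj_idx i = (if i \<le> m then i + m else if i \<le> 2 * m then i - m else i)"

definition tau :: "nat \<Rightarrow> 'a::field"
  where "tau i = (if m < i \<and> i \<le> 2 * m then - 1 else 1)"

text \<open>\<open>wbr_single i r a j s b\<close> is \<open>[a \<partial>\<^sub>i, b \<partial>\<^sub>j]\<close> for \<open>a\<close>, \<open>b\<close> homogeneous of parity \<open>r\<close>, \<open>s\<close>.\<close>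

definition wbr_single ::
    "nat \<Rightarrow> nat \<Rightarrow> 'a::field oelt \<Rightarrow> nat \<Rightarrow> nat \<Rightarrow> 'a oelt \<Rightarrow> 'a welt"
  where "wbr_single i r a j s b =
    wsingle j (omult a (oder i b))
    - wscale ((- 1) ^ ((r + mu i) * (s + mu j))) (wsingle i (omult b (oder j a)))"

definition wbr :: "'a::field welt \<Rightarrow> 'a welt \<Rightarrow> 'a welt"
  where "wbr D E = (\<Sum>i\<in>Y. \<Sum>j\<in>Y. \<Sum>r\<in>{0, 1}. \<Sum>s\<in>{0, 1}.
    wbr_single i r (opart r (D i)) j s (opart s (E j)))"

definition DH :: "'a::field oelt \<Rightarrow> 'a welt"
  where "DH a = (\<Sum>r\<in>{0, 1}. \<Sum>i\<in>Y.
    wscale (tau i * (- 1) ^ (mu i * r)) (wsingle (conj_idx i) (oder i (opart r a))))"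

definition ham_even :: "'a::field welt set"
  \<comment> \<open>the Lie algebra \<open>\<H>\<close>; here \<open>\<omega> = Y1\<close>\<close>
  where "ham_even = module.span wscale
    {DH (omono \<alpha> u) |\<alpha> u. \<alpha> \<in> idxA \<and> u \<in> idxB_even \<and> (\<alpha>, u) \<noteq> (top_idx, Y1)}"

definition ham_N :: "'a::field welt set"
  \<comment> \<open>\<open>\<NN>\<close>\<close>
  where "ham_N = module.span wscale
    {DH (omono \<alpha> u) |\<alpha> u. \<alpha> \<in> idxA \<and> u \<in> idxB_even \<and> (\<alpha>, u) \<noteq> (top_idx, Y1)
       \<and> (\<alpha>, u) \<noteq> (top_idx, {})}"

definition wact :: "'a::field welt \<Rightarrow> 'a oelt \<Rightarrow> 'a oelt"
  where "wact D f = (\<Sum>i\<in>Y. omult (D i) (oder i f))"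

definition gen :: "nat \<Rightarrow> 'a::field oelt"
  \<comment> \<open>the generator \<open>x\<^sub>i\<close>\<close>
  where "gen i = (if i \<in> Y0 then omono (unit_idx i) {} else omono 0 {i})"

lemma finite_Y: "finite Y0" "finite Y1" "finite Y"
  by (auto simp: Y0_def Y1_def Y_def)

lemma finite_obasis: "finite obasis"
proof -
  have "idxA \<subseteq> {f. \<forall>x. (x \<in> Y0 \<longrightarrow> f x \<in> (\<Union>i\<in>Y0. {..top_idx i})) \<and> (x \<notin> Y0 \<longrightarrow> f x = 0)}"
    by (auto simp: idxA_def)
  moreover have "finite {f. \<forall>x. (x \<in> Y0 \<longrightarrow> f x \<in> (\<Union>i\<in>Y0. {..top_idx i})) \<and> (x \<notin> Y0 \<longrightarrow> f x = (0::nat))}"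
    by (rule finite_set_of_finite_funs) (auto simp: finite_Y)
  ultimately show ?thesis
    unfolding obasis_def idxB_def using finite_Y by (auto intro: finite_subset)
qed

lemma sum_oelt_apply: "(\<Sum>b\<in>S. (F b :: 'a::field oelt)) c = (\<Sum>b\<in>S. F b c)"
  by (induction S rule: infinite_finite_induct) auto

lemma sum_oscale_omono:
  assumes "f \<in> osuper" shows "(\<Sum>b\<in>obasis. oscale (f b) (omono (fst b) (snd b))) = f"
proof
  fix c
  have "(\<Sum>b\<in>obasis. oscale (f b) (omono (fst b) (snd b))) c
      = (\<Sum>b\<in>obasis. if b = c then f c else 0)"
    unfolding sum_oelt_apply by (rule sum.cong) (auto simp: oscale_def omono_def)
  also have "\<dots> = f c" using assms by (cases c) (auto simp: finite_obasis osuper_def)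
  finally show "(\<Sum>b\<in>obasis. oscale (f b) (omono (fst b) (snd b))) c = f c" .
qed

lemma oder_omono: "(\<alpha>, u) \<in> obasis \<Longrightarrow> oder i (omono \<alpha> u) = bder i (\<alpha>, u)"
proof -
  assume a: "(\<alpha>, u) \<in> obasis"
  have "oder i (omono \<alpha> u) = (\<Sum>b\<in>obasis. if b = (\<alpha>, u) then bder i (\<alpha>, u) else (0 :: 'a oelt))"
    unfolding oder_def by (rule sum.cong) (auto simp: oscale_def omono_def fun_eq_iff)
  with a show ?thesis by (simp add: finite_obasis)
qed

lemma omult_one:
  fixes f :: "'a::field oelt"
  assumes "f \<in> osuper" shows "omult f (omono 0 {}) = f"
proof -
  have z: "(0, {}) \<in> obasis" by (auto simp: obasis_def idxA_def idxB_def)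
  have b: "bmult b (0, {}) = (omono (fst b) (snd b) :: 'a oelt)" if "b \<in> obasis" for b
    using that by (cases b) (auto simp: bmult_def obasis_def oscale_def)
  have "omult f (omono 0 {}) = (\<Sum>b\<in>obasis. \<Sum>c\<in>obasis.
      if c = (0, {}) then oscale (f b) (bmult b (0, {})) else 0)"
    unfolding omult_def by (intro sum.cong) (auto simp: omono_def oscale_def fun_eq_iff)
  also have "\<dots> = (\<Sum>b\<in>obasis. oscale (f b) (omono (fst b) (snd b)))"
    using z b by (intro sum.cong) (auto simp: finite_obasis)
  finally show ?thesis using sum_oscale_omono[OF assms] by simp
qed

lemma omult_zero: "omult f 0 = 0"
  by (simp add: omult_def oscale_def fun_eq_iff sum_oelt_apply)

lemma wact_gen:
  fixes D :: "'a::field welt"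
  assumes "D \<in> witt" "j \<in> Y" "p > 1" "\<forall>i\<in>Y0. t i > 0"
  shows "wact D (gen j) = D j"
proof -
  have p1: "1 \<le> p ^ t i - 1" if "i \<in> Y0" for i
    using one_less_power[of p "t i"] assms(3,4) that by fastforce
  have disj: "Y0 \<inter> Y1 = {}" by (auto simp: Y0_def Y1_def)
  have "oder i (gen j) = (if i = j then omono 0 {} else (0 :: 'a oelt))" if "i \<in> Y" for i
  proof (cases "j \<in> Y0")
    case True
    then have *: "(unit_idx j, {}) \<in> obasis"
      using p1 by (auto simp: obasis_def idxA_def idxB_def unit_idx_def top_idx_def)
    show ?thesis using True
      using oder_omono[OF *, of i, where 'a = 'a] that
      by (simp add: gen_def bder_def) (simp add: unit_idx_def zero_fun_def fun_diff_def disj)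
  next
    case False
    then have *: "(0, {j}) \<in> obasis"
      using assms(2) by (auto simp: obasis_def idxA_def idxB_def Y_def)
    have e: "{k. k = j \<and> k < j} = {}" by auto
    show ?thesis using False that disj
      using oder_omono[OF *, of i, where 'a = 'a]
      by (auto simp: gen_def bder_def oscale_def fun_eq_iff e)
  qed
  then have "wact D (gen j) = (\<Sum>i\<in>Y. if i = j then D j else 0)"
    unfolding wact_def using assms(1,2)
    by (intro sum.cong) (auto simp: omult_zero witt_def intro!: omult_one)
  then show ?thesis using assms(2) by (simp add: finite_Y)
qed

end

end

theory Submission
  imports Defs
begin

text \<open>
  For even \<open>f\<close> and \<open>g\<close> one has \<open>[D_H f, D_H g] = D_H {f, g}\<close> with the Poisson bracket
  \<open>{f, g} = D_H(f)(g)\<close>, and the point is that this bracket has two vanishing coefficients. A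
  derivative \<open>\<partial>\<^sub>i h\<close> never contains a monomial in which \<open>x\<^sub>i\<close> has its top exponent. By the Leibniz
  rule, \<open>\<partial>\<^sub>i f \<sqdot> \<partial>\<^bsub>i'\<^esub> g\<close> differs from the derivative \<open>\<partial>\<^sub>i (f \<sqdot> \<partial>\<^bsub>i'\<^esub> g)\<close> only by \<open>f \<sqdot> \<partial>\<^sub>i \<partial>\<^bsub>i'\<^esub> g\<close>, up to sign. For
  even \<open>i\<close> these corrections cancel between \<open>i\<close> and \<open>i'\<close>, since \<open>\<tau>\<close> changes sign; for odd \<open>i\<close> they
  vanish, since \<open>i' = i\<close> and \<open>\<partial>\<^sub>i\<^sup>2 = 0\<close>. So the coefficient of \<open>x^(\<pi>) x^\<omega>\<close> in \<open>{f, g}\<close> is zero. For the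
  coefficient of \<open>x^(\<pi>)\<close> the even indices are handled in the same way, while an odd index
  contributes a product of two odd elements, in which every monomial has an odd variable. Hence
  \<open>[\<H>, \<H>] \<subseteq> \<NN>\<close> (lemmas \<open>poisson_top_coeffs\<close> and \<open>wbr_ham_even\<close>): \<open>\<NN>\<close> contains the derived algebra,
  so it is an ideal.

  That \<open>\<H>\<close> is a Lie algebra also has to be shown. Its elements are even, and the even part of \<open>W\<close>
  acts on \<open>\<O>\<close> by derivations. The components of \<open>[D, E]\<close> are \<open>D(E\<^sub>k) - E(D\<^sub>k)\<close>, and
  \<open>[D, E]\<close> acts on \<open>\<O>\<close> as the commutator of the operators \<open>D\<close> and \<open>E\<close>, so the Jacobi identity follows
  as for operators (\<open>wact_wbr\<close>, \<open>lie_algebra_even_witt\<close>).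

  Everything rests on three properties of \<open>\<O>\<close>, checked on monomials: the product is associative
  and supercommutative, the partial derivatives obey the super Leibniz rule, and they
  supercommute. The Leibniz rule depends on the characteristic: when \<open>x^(\<alpha>) x^(\<beta>) = 0\<close>
  because the \<open>i\<close>-th exponents sum to \<open>p^t\<close>, the two terms on the right have to cancel, and they do
  since \<open>p\<close> divides the binomial coefficient \<open>p^t choose \<alpha>\<^sub>i\<close>.
\<close>

section \<open>Linear structure and parity\<close>

lemma vector_space_oscale: "vector_space (oscale :: 'a::field \<Rightarrow> 'a oelt \<Rightarrow> 'a oelt)"
  by unfold_locales (auto simp: oscale_def fun_eq_iff algebra_simps)

lemma vector_space_wscale: "vector_space (wscale :: 'a::field \<Rightarrow> 'a welt \<Rightarrow> 'a welt)"
  by unfold_locales (auto simp: oscale_def wscale_def fun_eq_iff algebra_simps)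

interpretation ospace: vector_space "oscale :: 'a::field \<Rightarrow> 'a oelt \<Rightarrow> 'a oelt"
  by (rule vector_space_oscale)

interpretation wspace: vector_space "wscale :: 'a::field \<Rightarrow> 'a welt \<Rightarrow> 'a welt"
  by (rule vector_space_wscale)

lemma oscale_apply: "oscale c f b = c * f b"
  by (simp add: oscale_def)

text \<open>
  The parity \<open>r\<close> is an arbitrary natural number that is read modulo 2, so that the parity of a
  product is simply the sum \<open>r + s\<close>.
\<close>

definition ohomog :: "nat \<Rightarrow> 'a::field oelt set"
  where "ohomog r = {f. \<forall>\<alpha> u. f (\<alpha>, u) \<noteq> 0 \<longrightarrow> card u mod 2 = r mod 2}"

lemma ohomog_subspace: "ospace.subspace (ohomog r)"
proof (rule ospace.subspaceI)
  fix f g :: "'a oelt"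
  assume "f \<in> ohomog r" "g \<in> ohomog r"
  then show "f + g \<in> ohomog r"
    unfolding ohomog_def by (auto simp: plus_fun_apply) (metis add.left_neutral)
qed (auto simp: ohomog_def oscale_def)

lemmas ohomog_zero = ospace.subspace_0[OF ohomog_subspace]
  and ohomog_add = ospace.subspace_add[OF ohomog_subspace]
  and ohomog_diff = ospace.subspace_diff[OF ohomog_subspace]
  and ohomog_scale = ospace.subspace_scale[OF ohomog_subspace]
  and ohomog_sum = ospace.subspace_sum[OF ohomog_subspace]

lemma ohomog_omono: "omono \<alpha> u \<in> ohomog r \<longleftrightarrow> card u mod 2 = r mod 2"
  by (auto simp: ohomog_def omono_def)

lemma opart_ohomog:
  assumes "f \<in> ohomog r" "s < 2"
  shows "opart s f = (if s = r mod 2 then f else 0)"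
  using assms by (auto simp: opart_def ohomog_def fun_eq_iff)

section \<open>Reordering signs\<close>

text \<open>
  The sign of the permutation that sorts the word \<open>x^u x^v\<close>. Written as a product over pairs it is
  multiplicative in both arguments, which reduces every sign computation below to commutative
  algebra. The sign in \<open>\<partial>x^u/\<partial>x\<^sub>i\<close> is the special case of moving \<open>x\<^sub>i\<close> through \<open>u\<close>.
\<close>

definition inv_sign :: "nat set \<Rightarrow> nat set \<Rightarrow> 'a::field"
  where "inv_sign u v = (\<Prod>k\<in>u. \<Prod>l\<in>v. if l < k then - 1 else 1)"

lemma prod_minus_one_card:
  "finite A \<Longrightarrow> (\<Prod>x\<in>A. if P x then - 1 else (1::'a::field)) = (- 1) ^ card {x \<in> A. P x}"
  by (simp add: prod.If_cases Int_def conj_commute)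

lemma inv_sign_eq_card:
  assumes "finite u" "finite v"
  shows "(- 1) ^ card {(k, l). k \<in> u \<and> l \<in> v \<and> l < k} = (inv_sign u v :: 'a::field)"
proof -
  have "inv_sign u v = (\<Prod>x\<in>u \<times> v. if snd x < fst x then - 1 else (1::'a))"
    unfolding inv_sign_def using assms by (simp add: prod.cartesian_product case_prod_beta)
  also have "\<dots> = (- 1) ^ card {x \<in> u \<times> v. snd x < fst x}"
    by (rule prod_minus_one_card) (use assms in auto)
  also have "{x \<in> u \<times> v. snd x < fst x} = {(k, l). k \<in> u \<and> l \<in> v \<and> l < k}" by auto
  finally show ?thesis by simp
qed

lemma inv_sign_singleton:
  "finite u \<Longrightarrow> (- 1) ^ card {k \<in> u. k < i} = (inv_sign {i} u :: 'a::field)"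
  by (simp add: inv_sign_def prod_minus_one_card)

lemma inv_sign_self [simp]: "inv_sign {i} {i} = 1"
  by (simp add: inv_sign_def)

lemma inv_sign_union_left:
  "finite u \<Longrightarrow> finite v \<Longrightarrow> u \<inter> v = {} \<Longrightarrow> inv_sign (u \<union> v) w = inv_sign u w * inv_sign v w"
  by (simp add: inv_sign_def prod.union_disjoint)

lemma inv_sign_union_right:
  "finite v \<Longrightarrow> finite w \<Longrightarrow> v \<inter> w = {} \<Longrightarrow> inv_sign u (v \<union> w) = inv_sign u v * inv_sign u w"
  by (simp add: inv_sign_def prod.union_disjoint prod.distrib)

lemma inv_sign_insert_left:
  "finite u \<Longrightarrow> i \<notin> u \<Longrightarrow> inv_sign (insert i u) w = inv_sign {i} w * inv_sign u w"
  by (simp add: inv_sign_def)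

lemma inv_sign_insert_right:
  "finite w \<Longrightarrow> i \<notin> w \<Longrightarrow> inv_sign u (insert i w) = inv_sign u {i} * inv_sign u w"
  by (simp add: inv_sign_def prod.distrib)

lemma inv_sign_square: "inv_sign u v * inv_sign u v = 1"
  unfolding inv_sign_def prod.distrib[symmetric] by (intro prod.neutral ballI) auto

lemma inv_sign_swap:
  assumes "u \<inter> v = {}"
  shows "inv_sign u v = (- 1) ^ (card u * card v) * inv_sign v u"
proof -
  have "inv_sign u v * inv_sign v u
      = (\<Prod>k\<in>u. \<Prod>l\<in>v. (if l < k then - 1 else 1) * (if k < l then - 1 else 1))"
    unfolding inv_sign_def prod.distrib by (subst (2) prod.swap) (rule refl)
  also have "\<dots> = (\<Prod>k\<in>u. \<Prod>l\<in>v. - 1)"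
    by (intro prod.cong refl) (use assms in auto)
  also have "\<dots> = (- 1) ^ (card u * card v)"
    by (simp add: power_mult[symmetric] mult.commute)
  finally have "inv_sign u v * inv_sign v u = (- 1) ^ (card u * card v)" .
  then have "inv_sign u v * inv_sign v u * inv_sign v u = (- 1) ^ (card u * card v) * inv_sign v u"
    by (rule arg_cong[where f = "\<lambda>x. x * inv_sign v u"])
  then show ?thesis by (simp only: mult.assoc inv_sign_square mult_1_right)
qed

section \<open>The divided power superalgebra\<close>

context superalgebra_params
begin

lemma finite_idxB: "u \<in> idxB \<Longrightarrow> finite u"
  using finite_Y by (auto simp: idxB_def intro: finite_subset)

lemma Y0_disjoint_Y1: "Y0 \<inter> Y1 = {}"
  by (auto simp: Y0_def Y1_def)

lemma osuper_subspace: "ospace.subspace osuper"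
  by (rule ospace.subspaceI) (auto simp: osuper_def oscale_def)

lemmas osuper_zero = ospace.subspace_0[OF osuper_subspace]
  and osuper_add = ospace.subspace_add[OF osuper_subspace]
  and osuper_diff = ospace.subspace_diff[OF osuper_subspace]
  and osuper_scale = ospace.subspace_scale[OF osuper_subspace]
  and osuper_sum = ospace.subspace_sum[OF osuper_subspace]

lemma osuper_omono: "omono \<alpha> u \<in> osuper \<longleftrightarrow> (\<alpha>, u) \<in> obasis"
  by (auto simp: osuper_def omono_def)

text \<open>
  An identity that is linear in \<open>f\<close> has to be verified on the monomials that occur in \<open>f\<close> only; if
  \<open>f\<close> is homogeneous, then these monomials have the parity of \<open>f\<close>.
\<close>

lemma osuper_induct [consumes 1, case_names zero add mono]:
  assumes f: "f \<in> osuper"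
    and zero: "P 0" and add: "\<And>f g. P f \<Longrightarrow> P g \<Longrightarrow> P (f + g)"
    and mono: "\<And>c \<alpha> u. (\<alpha>, u) \<in> obasis \<Longrightarrow> f (\<alpha>, u) \<noteq> 0 \<Longrightarrow> P (oscale c (omono \<alpha> u))"
  shows "P f"
proof -
  have "P (\<Sum>b\<in>B. oscale (f b) (omono (fst b) (snd b)))" if "finite B" "B \<subseteq> obasis" for B
    using that
  proof (induction B)
    case empty
    show ?case by (simp only: sum.empty zero)
  next
    case (insert b B)
    have A: "P (oscale (f b) (omono (fst b) (snd b)))"
      using insert.prems mono[of "fst b" "snd b"] zero by (cases "f b = 0") auto
      have B: "P (\<Sum>b\<in>B. oscale (f b) (omono (fst b) (snd b)))" using insert by simp
    show ?case unfolding sum.insert[OF insert.hyps] by (rule add[OF A B])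
  qed
  from this[OF finite_obasis order_refl] show ?thesis by (simp add: sum_oscale_omono[OF f])
qed

lemma oder_add: "oder i (f + g) = oder i f + oder i g"
  by (simp add: oder_def ospace.scale_left_distrib sum.distrib)

lemma oder_scale: "oder i (oscale c f) = oscale c (oder i f)"
  by (simp add: oder_def ospace.scale_sum_right oscale_apply)

lemma oder_linear: "Vector_Spaces.linear oscale oscale (oder i)"
  by (simp add: Vector_Spaces.linear_def vector_space_oscale module_hom_def module_hom_axioms_def
      ospace.module_axioms oder_add oder_scale)

lemma oder_zero: "oder i 0 = 0"
  and oder_diff: "oder i (f - g) = oder i f - oder i g"
  and oder_sum: "oder i (\<Sum>x\<in>S. F x) = (\<Sum>x\<in>S. oder i (F x))"
proof -
  interpret Vector_Spaces.linear oscale oscale "oder i" by (rule oder_linear)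
  show "oder i 0 = 0" by (rule zero)
  show "oder i (f - g) = oder i f - oder i g" by (rule diff)
  show "oder i (\<Sum>x\<in>S. F x) = (\<Sum>x\<in>S. oder i (F x))" by (rule sum)
qed

lemma omult_add_left: "omult (f + g) h = omult f h + omult g h"
  by (simp add: omult_def distrib_right ospace.scale_left_distrib sum.distrib)

lemma omult_add_right: "omult h (f + g) = omult h f + omult h g"
  by (simp add: omult_def distrib_left ospace.scale_left_distrib sum.distrib)

lemma omult_scale_left: "omult (oscale c f) g = oscale c (omult f g)"
  by (simp add: omult_def ospace.scale_sum_right oscale_apply mult.assoc)

lemma omult_scale_right: "omult f (oscale c g) = oscale c (omult f g)"
  by (simp add: omult_def ospace.scale_sum_right oscale_apply mult.left_commute)

lemma omult_linear:
  "Vector_Spaces.linear oscale oscale (omult f)" "Vector_Spaces.linear oscale oscale (\<lambda>f. omult f g)"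
  by (simp_all add: Vector_Spaces.linear_def vector_space_oscale module_hom_def module_hom_axioms_def
      ospace.module_axioms omult_add_left omult_add_right omult_scale_left omult_scale_right)

lemma omult_zero_right: "omult f 0 = 0"
  and omult_diff_right: "omult f (g - h) = omult f g - omult f h"
  and omult_sum_right: "omult f (\<Sum>x\<in>S. F x) = (\<Sum>x\<in>S. omult f (F x))"
proof -
  interpret Vector_Spaces.linear oscale oscale "omult f" by (rule omult_linear)
  show "omult f 0 = 0" by (rule zero)
  show "omult f (g - h) = omult f g - omult f h" by (rule diff)
  show "omult f (\<Sum>x\<in>S. F x) = (\<Sum>x\<in>S. omult f (F x))" by (rule sum)
qed

lemma omult_zero_left: "omult 0 f = 0"
  and omult_diff_left: "omult (g - h) f = omult g f - omult h f"
  and omult_sum_left: "omult (\<Sum>x\<in>S. F x) f = (\<Sum>x\<in>S. omult (F x) f)"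
proof -
  interpret Vector_Spaces.linear oscale oscale "\<lambda>g. omult g f" by (rule omult_linear)
  show "omult 0 f = 0" by (rule zero)
  show "omult (g - h) f = omult g f - omult h f" by (rule diff)
  show "omult (\<Sum>x\<in>S. F x) f = (\<Sum>x\<in>S. omult (F x) f)" by (rule sum)
qed

definition bincoeff :: "(nat \<Rightarrow> nat) \<Rightarrow> (nat \<Rightarrow> nat) \<Rightarrow> nat"
  where "bincoeff \<alpha> \<beta> = (\<Prod>i\<in>Y0. (\<alpha> i + \<beta> i) choose \<alpha> i)"

lemma omult_omono:
  fixes \<alpha> \<beta> :: "nat \<Rightarrow> nat"
  assumes "(\<alpha>, u) \<in> obasis" "(\<beta>, v) \<in> obasis"
  shows "omult (omono \<alpha> u) (omono \<beta> v) =
    (if \<alpha> + \<beta> \<in> idxA \<and> u \<inter> v = {}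
     then oscale (of_nat (bincoeff \<alpha> \<beta>) * inv_sign u v) (omono (\<alpha> + \<beta>) (u \<union> v))
     else (0 :: 'a::field oelt))"
proof -
  have fin: "finite u" "finite v" using assms by (auto simp: obasis_def finite_idxB)
  have "omult (omono \<alpha> u) (omono \<beta> v) = (\<Sum>b\<in>obasis. \<Sum>c\<in>obasis.
      if c = (\<beta>, v) then (if b = (\<alpha>, u) then bmult b (\<beta>, v) else 0) else (0 :: 'a oelt))"
    unfolding omult_def by (intro sum.cong) (auto simp: omono_def oscale_def fun_eq_iff)
  also have "\<dots> = bmult (\<alpha>, u) (\<beta>, v)"
    using assms by (simp add: finite_obasis)
  finally show ?thesis
    by (simp add: bmult_def bincoeff_def inv_sign_eq_card[OF fin])
qed

lemma oder_omono_even: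
  assumes "(\<alpha>, u) \<in> obasis" "i \<in> Y0"
  shows "oder i (omono \<alpha> u) = (if \<alpha> i = 0 then 0 else omono (\<alpha> - unit_idx i) u)"
  using assms by (simp add: oder_omono bder_def)

lemma oder_omono_odd:
  assumes "(\<alpha>, u) \<in> obasis" "i \<in> Y1"
  shows "oder i (omono \<alpha> u) =
    (if i \<in> u then oscale (inv_sign {i} u) (omono \<alpha> (u - {i})) else 0)"
  using assms Y0_disjoint_Y1
  by (auto simp: oder_omono bder_def obasis_def inv_sign_singleton finite_idxB)

lemma obasis_lower: "(\<alpha>, u) \<in> obasis \<Longrightarrow> (\<alpha> - unit_idx i, u) \<in> obasis"
  by (auto simp: obasis_def idxA_def intro: order_trans[OF diff_le_self])

lemma obasis_remove: "(\<alpha>, u) \<in> obasis \<Longrightarrow> (\<alpha>, u - v) \<in> obasis"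
  by (auto simp: obasis_def idxB_def)

lemma obasis_plus:
  "(\<alpha>, u) \<in> obasis \<Longrightarrow> (\<beta>, v) \<in> obasis \<Longrightarrow> \<alpha> + \<beta> \<in> idxA \<Longrightarrow> (\<alpha> + \<beta>, u \<union> v) \<in> obasis"
  by (auto simp: obasis_def idxB_def)

text \<open>
  From here on, elements of \<open>\<O>\<close> and \<open>W\<close> are handled as vectors; evaluating sums of them pointwise
  would undo the linearity rules.
\<close>

declare zero_fun_apply [simp del] plus_fun_apply [simp del] minus_apply [simp del] uminus_apply [simp del]

lemma oder_osuper:
  assumes "f \<in> osuper" "i \<in> Y"
  shows "oder i f \<in> osuper"
  using assms(1)
proof (induction f rule: osuper_induct)
  case (mono c \<alpha> u)
  then show ?case using assms(2)
    by (auto simp: oder_scale oder_omono_even oder_omono_odd Y_def osuper_zero osuper_omono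
        obasis_lower obasis_remove intro!: osuper_scale)
qed (simp_all add: oder_zero osuper_zero oder_add osuper_add)

lemma omult_osuper:
  assumes "f \<in> osuper" "g \<in> osuper"
  shows "omult f g \<in> osuper"
  using assms(1)
proof (induction f rule: osuper_induct)
  case (mono c \<alpha> u)
  note u = mono
  show ?case using assms(2)
  proof (induction g rule: osuper_induct)
    case (mono d \<beta> v)
    then show ?case using u
      by (auto simp: omult_scale_left omult_scale_right omult_omono osuper_zero osuper_omono
          obasis_plus intro!: osuper_scale)
  qed (simp_all add: omult_zero_right omult_add_right osuper_zero osuper_add)
qed (simp_all add: omult_zero_left omult_add_left osuper_zero osuper_add)

lemma oder_ohomog:
  fixes f :: "'a::field oelt"
  assumes "f \<in> osuper" "f \<in> ohomog r" "i \<in> Y"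
  shows "oder i f \<in> ohomog (mu i + r)"
  using assms(1)
proof (induction f rule: osuper_induct)
  case (mono c \<alpha> u)
  have r: "card u mod 2 = r mod 2" using mono(2) assms(2) unfolding ohomog_def by blast
  show ?case
  proof (cases "i \<in> Y0")
    case True
    then have "mu i = 0" using Y0_disjoint_Y1 by (auto simp: mu_def)
    then have "oder i (omono \<alpha> u) \<in> (ohomog (mu i + r) :: 'a oelt set)"
      using True mono(1) r by (simp add: oder_omono_even ohomog_omono ohomog_zero)
    then show ?thesis by (simp only: oder_scale ohomog_scale)
  next
    case False
    then have i: "i \<in> Y1" "mu i = 1" using assms(3) by (auto simp: mu_def Y_def)
    have "card (u - {i}) mod 2 = (1 + r) mod 2" if "i \<in> u"
    proof -
      have "finite u" using mono(1) finite_idxB by (auto simp: obasis_def)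
      then have "card u = Suc (card (u - {i}))" using that by (rule card.remove)
      then have "card u mod 2 = (1 + card (u - {i})) mod 2" by simp
      then show ?thesis using r by presburger
    qed
    then have "oder i (omono \<alpha> u) \<in> (ohomog (mu i + r) :: 'a oelt set)"
      using i mono(1) by (simp add: oder_omono_odd ohomog_omono ohomog_zero ohomog_scale del: card_Diff_insert)
    then show ?thesis by (simp only: oder_scale ohomog_scale)
  qed
qed (use ohomog_zero ohomog_add in \<open>simp_all only: oder_zero oder_add\<close>)

lemma omult_ohomog:
  fixes f :: "'a::field oelt"
  assumes "f \<in> osuper" "f \<in> ohomog r" "g \<in> osuper" "g \<in> ohomog s"
  shows "omult f g \<in> ohomog (r + s)"
  using assms(1)
proof (induction f rule: osuper_induct)
  case (mono c \<alpha> u)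
  note u = mono
  have r: "card u mod 2 = r mod 2" using mono(2) assms(2) unfolding ohomog_def by blast
  show ?case using assms(3)
  proof (induction g rule: osuper_induct)
    case (mono d \<beta> v)
    have s: "card v mod 2 = s mod 2" using mono(2) assms(4) unfolding ohomog_def by blast
    have "card (u \<union> v) mod 2 = (r + s) mod 2" if "u \<inter> v = {}"
    proof -
      have "finite u" "finite v" using u(1) mono(1) finite_idxB by (auto simp: obasis_def)
      then have "card (u \<union> v) = card u + card v" using that by (rule card_Un_disjoint)
      then show ?thesis using r s by (metis mod_add_eq)
    qed
    then have "omult (omono \<alpha> u) (omono \<beta> v) \<in> (ohomog (r + s) :: 'a oelt set)"
      using u(1) mono(1) by (simp add: omult_omono ohomog_zero ohomog_omono ohomog_scale)
    then show ?case by (simp only: omult_scale_left omult_scale_right ohomog_scale)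
  qed (simp_all add: omult_zero_right omult_add_right ohomog_zero ohomog_add)
qed (simp_all add: omult_zero_left omult_add_left ohomog_zero ohomog_add)

text \<open>
  On monomials the binomial coefficients are symmetric, and sorting \<open>x^u x^v\<close> instead of \<open>x^v x^u\<close>
  costs one sign for each of the \<open>|u| |v|\<close> pairs.
\<close>

lemma omult_supercommute:
  fixes f :: "'a::field oelt"
  assumes "f \<in> osuper" "f \<in> ohomog r" "g \<in> osuper" "g \<in> ohomog s"
  shows "omult f g = oscale ((- 1) ^ (r * s)) (omult g f)"
  using assms(1)
proof (induction f rule: osuper_induct)
  case (mono c \<alpha> u)
  note u = mono
  have r: "card u mod 2 = r mod 2" using mono(2) assms(2) unfolding ohomog_def by blast
  show ?case using assms(3)
  proof (induction g rule: osuper_induct)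
    case (mono d \<beta> v)
    have s: "card v mod 2 = s mod 2" using mono(2) assms(4) unfolding ohomog_def by blast
    have "even (card u * card v) = even (r * s)"
      using r s by (simp add: even_iff_mod_2_eq_zero[symmetric] even_mult_iff) (metis even_iff_mod_2_eq_zero)
    then have "(- 1 :: 'a) ^ (card u * card v) = (- 1) ^ (r * s)" by (simp add: minus_one_power_iff)
    moreover have "bincoeff \<alpha> \<beta> = bincoeff \<beta> \<alpha>"
      unfolding bincoeff_def
      using binomial_symmetric[OF le_add1] by (intro prod.cong refl) (simp add: add.commute)
    ultimately have "omult (omono \<alpha> u) (omono \<beta> v) = oscale ((- 1) ^ (r * s)) (omult (omono \<beta> v) (omono \<alpha> u :: 'a oelt))"
      using u(1) mono(1) inv_sign_swap[of u v, where 'a='a]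
      by (simp add: omult_omono add.commute Un_commute Int_commute mult.left_commute)
    then show ?case
      by (simp add: omult_scale_left omult_scale_right mult_ac)
  qed (simp_all add: omult_zero_left omult_zero_right omult_add_left omult_add_right ospace.scale_right_distrib)
qed (simp_all add: omult_zero_left omult_zero_right omult_add_left omult_add_right ospace.scale_right_distrib)

lemma idxA_summands:
  assumes "\<alpha> + \<beta> \<in> idxA" shows "\<alpha> \<in> idxA" "\<beta> \<in> idxA"
  using assms by (auto simp: idxA_def plus_fun_apply intro: add_leD1 add_leD2)

lemma bincoeff_assoc:
  "bincoeff \<alpha> \<beta> * bincoeff (\<alpha> + \<beta>) \<gamma> = bincoeff \<beta> \<gamma> * bincoeff \<alpha> (\<beta> + \<gamma>)"
proof -
  have "(a + b choose a) * (a + b + c choose (a + b)) = (b + c choose b) * (a + (b + c) choose a)"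
    for a b c :: nat
    using choose_mult_lemma[of b c a] binomial_symmetric[of a "a + b + c"]
    by (simp add: ac_simps)
  then show ?thesis
    unfolding bincoeff_def prod.distrib[symmetric] by (intro prod.cong) (simp_all add: plus_fun_apply)
qed

text \<open>
  Truncation does no harm to associativity: if \<open>\<alpha> + \<beta> + \<gamma>\<close> is admissible, then so are all partial
  sums, and otherwise both sides vanish. The coefficients agree as multinomial coefficients and the
  signs by multiplicativity.
\<close>

lemma omult_assoc_omono:
  assumes "(\<alpha>, u) \<in> obasis" "(\<beta>, v) \<in> obasis" "(\<gamma>, w) \<in> obasis"
  shows "omult (omult (omono \<alpha> u) (omono \<beta> v)) (omono \<gamma> w)
    = omult (omono \<alpha> u) (omult (omono \<beta> v) (omono \<gamma> w) :: 'a::field oelt)"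
proof (cases "\<alpha> + \<beta> + \<gamma> \<in> idxA \<and> u \<inter> v = {} \<and> u \<inter> w = {} \<and> v \<inter> w = {}")
  case True
  then have A: "\<alpha> + \<beta> \<in> idxA" "\<beta> + \<gamma> \<in> idxA" "\<alpha> + (\<beta> + \<gamma>) \<in> idxA"
    using idxA_summands[of "\<alpha> + \<beta>" \<gamma>] idxA_summands[of \<alpha> "\<beta> + \<gamma>"] by (simp_all add: add.assoc)
  have fin: "finite u" "finite v" "finite w" using assms finite_idxB by (auto simp: obasis_def)
  have B: "(\<alpha> + \<beta>, u \<union> v) \<in> obasis" "(\<beta> + \<gamma>, v \<union> w) \<in> obasis"
    using A assms by (simp_all add: obasis_plus)
  have c: "of_nat (bincoeff \<alpha> \<beta>) * of_nat (bincoeff (\<alpha> + \<beta>) \<gamma>)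
      = (of_nat (bincoeff \<beta> \<gamma>) * of_nat (bincoeff \<alpha> (\<beta> + \<gamma>)) :: 'a)"
    unfolding of_nat_mult[symmetric] bincoeff_assoc ..
  have s: "inv_sign u v * inv_sign (u \<union> v) w = (inv_sign v w * inv_sign u (v \<union> w) :: 'a)"
    using True fin by (simp add: inv_sign_union_left inv_sign_union_right)
  have "omult (omult (omono \<alpha> u) (omono \<beta> v)) (omono \<gamma> w)
      = oscale ((of_nat (bincoeff \<alpha> \<beta>) * of_nat (bincoeff (\<alpha> + \<beta>) \<gamma>))
          * (inv_sign u v * inv_sign (u \<union> v) w)) (omono (\<alpha> + \<beta> + \<gamma>) (u \<union> v \<union> w) :: 'a oelt)"
    using True A B assms
    by (simp add: omult_omono omult_scale_left Int_Un_distrib2 mult_ac)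
  also have "\<dots> = omult (omono \<alpha> u) (omult (omono \<beta> v) (omono \<gamma> w))"
    unfolding c s using True A B assms
    by (simp add: omult_omono omult_scale_right Int_Un_distrib mult_ac add.assoc Un_assoc)
  finally show ?thesis .
next
  case False
  have "omult (omult (omono \<alpha> u) (omono \<beta> v)) (omono \<gamma> w) = (0 :: 'a oelt)"
    using assms False
    by (cases "\<alpha> + \<beta> \<in> idxA \<and> u \<inter> v = {}")
       (auto simp: omult_omono omult_scale_left omult_zero_left obasis_plus Int_Un_distrib2)
  moreover have "omult (omono \<alpha> u) (omult (omono \<beta> v) (omono \<gamma> w)) = (0 :: 'a oelt)"
    using assms False
    by (cases "\<beta> + \<gamma> \<in> idxA \<and> v \<inter> w = {}")
       (auto simp: omult_omono omult_scale_right omult_zero_right obasis_plus Int_Un_distrib add.assoc)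
  ultimately show ?thesis by simp
qed

lemma omult_assoc:
  fixes f :: "'a::field oelt"
  assumes "f \<in> osuper" "g \<in> osuper" "h \<in> osuper"
  shows "omult (omult f g) h = omult f (omult g h)"
  using assms(1)
proof (induction f rule: osuper_induct)
  case (mono a \<alpha> u)
  note u = mono(1)
  show ?case using assms(2)
  proof (induction g rule: osuper_induct)
    case (mono b \<beta> v)
    note v = mono(1)
    show ?case using assms(3)
    proof (induction h rule: osuper_induct)
      case (mono c \<gamma> w)
      show ?case
        by (simp add: omult_scale_left omult_scale_right omult_assoc_omono[OF u v mono(1)])
    qed (simp_all add: omult_zero_right omult_add_right)
  qed (simp_all add: omult_zero_left omult_zero_right omult_add_left omult_add_right)
qed (simp_all add: omult_zero_left omult_add_left)

end

section \<open>The Leibniz rule in characteristic p\<close>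

lemma of_nat_choose_prime_power_eq_0:
  assumes "CHAR('a::field) = p" "prime p" "0 < k" "k < p ^ e"
  shows "of_nat (p ^ e choose k) = (0 :: 'a)"
proof -
  have "p dvd (p ^ e choose k)"
  proof (rule ccontr)
    assume "\<not> p dvd (p ^ e choose k)"
    then have "coprime (p ^ e) (p ^ e choose k)"
      using assms(2) by (simp add: prime_imp_coprime)
    moreover have "p ^ e dvd k * (p ^ e choose k)"
      using assms(3) by (simp add: times_binomial_minus1_eq)
    ultimately have "p ^ e dvd k" using coprime_dvd_mult_left_iff by blast
    then show False using assms(3,4) by (auto dest: dvd_imp_le)
  qed
  then show ?thesis using assms(1) by (simp add: of_nat_eq_0_iff_char_dvd)
qed

locale modular_superalgebra = superalgebra_params p m n t for p m n :: nat and t +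
  fixes ty :: "'a::field itself"
  assumes char_eq: "CHAR('a) = p" and prime_p: "prime p"
begin

lemma mu_Y0: "i \<in> Y0 \<Longrightarrow> mu i = 0"
  using Y0_disjoint_Y1 by (auto simp: mu_def)

lemma mu_Y1: "i \<in> Y1 \<Longrightarrow> mu i = 1"
  by (simp add: mu_def)

lemma bincoeff_remove:
  "i \<in> Y0 \<Longrightarrow> bincoeff \<alpha> \<beta> = (\<alpha> i + \<beta> i choose \<alpha> i) * (\<Prod>k\<in>Y0 - {i}. \<alpha> k + \<beta> k choose \<alpha> k)"
  unfolding bincoeff_def by (rule prod.remove) (use finite_Y in auto)

text \<open>
  All three terms are multiples of the monomial with exponent \<open>\<gamma> = \<alpha> + \<beta> - \<epsilon>\<^sub>i\<close>, and if \<open>\<alpha> + \<beta>\<close> is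
  admissible, their coefficients are related by Pascal's rule. The delicate case is that \<open>\<gamma>\<close> is
  admissible but \<open>\<alpha> + \<beta>\<close> is not. Then the left-hand side vanishes, while Pascal's rule gives the
  coefficient \<open>p^t choose \<alpha>\<^sub>i\<close> on the right, which is zero in characteristic \<open>p\<close>.
\<close>

lemma oder_omult_omono_even:
  assumes \<alpha>: "(\<alpha>, u) \<in> obasis" and \<beta>: "(\<beta>, v) \<in> obasis" and i: "i \<in> Y0"
  shows "oder i (omult (omono \<alpha> u) (omono \<beta> v)) =
    omult (oder i (omono \<alpha> u)) (omono \<beta> v) + omult (omono \<alpha> u) (oder i (omono \<beta> v) :: 'a oelt)"
proof (cases "u \<inter> v = {} \<and> \<alpha> i + \<beta> i > 0")
  case False
  then show ?thesis
    using assms obasis_lower[OF \<alpha>, of i] obasis_lower[OF \<beta>, of i]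
    by (auto simp: omult_omono oder_omono_even oder_zero omult_zero_left omult_zero_right oder_scale
        obasis_plus plus_fun_apply)
next
  case True
  define \<gamma> where "\<gamma> = \<alpha> + \<beta> - unit_idx i"
  define q where "q = (\<Prod>k\<in>Y0 - {i}. \<alpha> k + \<beta> k choose \<alpha> k)"
  define E :: "'a oelt" where "E = oscale (inv_sign u v) (omono \<gamma> (u \<union> v))"
  let ?a = "\<alpha> i" and ?b = "\<beta> i"
  have l: "\<alpha> - unit_idx i + \<beta> = \<gamma>" if "?a > 0"
    using that by (auto simp: \<gamma>_def fun_eq_iff unit_idx_def plus_fun_apply minus_apply)
  have r: "\<alpha> + (\<beta> - unit_idx i) = \<gamma>" if "?b > 0"
    using that by (auto simp: \<gamma>_def fun_eq_iff unit_idx_def plus_fun_apply minus_apply)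
  have bl: "bincoeff (\<alpha> - unit_idx i) \<beta> = (?a - 1 + ?b choose (?a - 1)) * q"
    unfolding bincoeff_remove[OF i] q_def
    by (auto simp: unit_idx_def minus_apply intro!: arg_cong2[where f = "(*)"] prod.cong)
  have br: "bincoeff \<alpha> (\<beta> - unit_idx i) = (?a + (?b - 1) choose ?a) * q"
    unfolding bincoeff_remove[OF i] q_def
    by (auto simp: unit_idx_def minus_apply intro!: arg_cong2[where f = "(*)"] prod.cong)
  have b: "bincoeff \<alpha> \<beta> = (?a + ?b choose ?a) * q"
    unfolding bincoeff_remove[OF i] q_def ..
  define cl where "cl = (if ?a = 0 then 0 else (?a - 1 + ?b choose (?a - 1)))"
  define cr where "cr = (if ?b = 0 then 0 else (?a + (?b - 1) choose ?a))"
  \<comment> \<open>The case distinctions in \<open>cl\<close> and \<open>cr\<close> account for \<open>\<partial>\<^sub>i\<close> killing a monomial without \<open>x\<^sub>i\<close>.\<close>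
  have pascal: "?a + ?b choose ?a = cl + cr"
  proof (cases "?a = 0 \<or> ?b = 0")
    case False
    then obtain a b where "?a = Suc a" "?b = Suc b" by (metis not0_implies_Suc)
    then show ?thesis by (simp add: cl_def cr_def)
  qed (use True in \<open>auto simp: cl_def cr_def\<close>)
  have L: "omult (oder i (omono \<alpha> u)) (omono \<beta> v) = (if \<gamma> \<in> idxA then oscale (of_nat (cl * q)) E else 0)"
    using True \<alpha> \<beta> i obasis_lower[OF \<alpha>, of i] l bl
    by (auto simp: oder_omono_even omult_omono omult_zero_left E_def cl_def)
  have R: "omult (omono \<alpha> u) (oder i (omono \<beta> v)) = (if \<gamma> \<in> idxA then oscale (of_nat (cr * q)) E else 0)"
    using True \<alpha> \<beta> i obasis_lower[OF \<beta>, of i] r br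
    by (auto simp: oder_omono_even omult_omono omult_zero_right E_def cr_def)
  have "oder i (omult (omono \<alpha> u) (omono \<beta> v))
      = (if \<gamma> \<in> idxA then oscale (of_nat ((?a + ?b choose ?a) * q)) E else 0)"
  proof (cases "\<alpha> + \<beta> \<in> idxA")
    case A: True
    then have "\<gamma> \<in> idxA" unfolding \<gamma>_def
      by (auto simp: idxA_def minus_apply intro: order_trans[OF diff_le_self])
    moreover have "(\<alpha> + \<beta>) i \<noteq> 0" using True by (simp add: plus_fun_apply)
    ultimately show ?thesis using A True \<alpha> \<beta> i
      by (simp add: omult_omono oder_scale oder_omono_even obasis_plus b E_def \<gamma>_def)
  next
    case A: False
    have "of_nat (?a + ?b choose ?a) = (0 :: 'a)" if "\<gamma> \<in> idxA"
    proof -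
      have ab: "?a \<le> top_idx i" "?b \<le> top_idx i" using \<alpha> \<beta> i by (auto simp: obasis_def idxA_def)
      have "\<exists>k\<in>Y0. \<alpha> k + \<beta> k > top_idx k"
        using A \<alpha> \<beta> by (auto simp: obasis_def idxA_def plus_fun_apply not_le)
      moreover have "\<alpha> k + \<beta> k \<le> top_idx k" if "k \<in> Y0" "k \<noteq> i" for k
        using \<open>\<gamma> \<in> idxA\<close> that
        by (auto simp: idxA_def \<gamma>_def unit_idx_def plus_fun_apply minus_apply dest!: bspec[of _ _ k])
      ultimately have "?a + ?b > top_idx i" by fastforce
      moreover have "?a + ?b - 1 \<le> top_idx i"
        using \<open>\<gamma> \<in> idxA\<close> i
        by (auto simp: idxA_def \<gamma>_def unit_idx_def plus_fun_apply minus_apply dest!: bspec[of _ _ i])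
      moreover have "top_idx i = p ^ t i - 1" using i by (simp add: top_idx_def)
      moreover have "p ^ t i > 0" using prime_p by (simp add: prime_gt_0_nat)
      ultimately have "?a + ?b = p ^ t i" "0 < ?a" "?a < p ^ t i" using ab by linarith+
      then show ?thesis using of_nat_choose_prime_power_eq_0[OF char_eq prime_p] by simp
    qed
    then show ?thesis using A True \<alpha> \<beta> by (simp add: omult_omono oder_zero)
  qed
  then show ?thesis
    by (simp add: L R pascal distrib_right ospace.scale_left_distrib)
qed

text \<open>
  Up to the trivial cases, \<open>x\<^sub>i\<close> occurs in exactly one factor, and the signs match by multiplicativity,
  or it occurs in both. In that last case the product is zero because \<open>x\<^sub>i\<^sup>2 = 0\<close>, and the two terms on
  the right are the same monomial with opposite signs.
\<close>

lemma oder_omult_omono_odd: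
  assumes \<alpha>: "(\<alpha>, u) \<in> obasis" and \<beta>: "(\<beta>, v) \<in> obasis" and i: "i \<in> Y1"
  shows "oder i (omult (omono \<alpha> u) (omono \<beta> v)) =
    omult (oder i (omono \<alpha> u)) (omono \<beta> v)
    + oscale ((- 1) ^ card u) (omult (omono \<alpha> u) (oder i (omono \<beta> v) :: 'a oelt))"
proof (cases "\<alpha> + \<beta> \<in> idxA \<and> (u - {i}) \<inter> (v - {i}) = {} \<and> (i \<in> u \<or> i \<in> v)")
  case False
  then consider "\<alpha> + \<beta> \<notin> idxA" | "i \<notin> u" "i \<notin> v" | "(u - {i}) \<inter> (v - {i}) \<noteq> {}" by blast
  then show ?thesis
  proof cases
    case 1
    then show ?thesis using assms obasis_remove[OF \<alpha>, of "{i}"] obasis_remove[OF \<beta>, of "{i}"]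
      by (simp add: omult_omono oder_omono_odd oder_zero omult_zero_left omult_zero_right
          omult_scale_left omult_scale_right)
  next
    case 2
    then show ?thesis using assms
      by (simp add: omult_omono oder_omono_odd oder_zero oder_scale omult_zero_left omult_zero_right
          obasis_plus)
  next
    case 3
    then have "u \<inter> v \<noteq> {}" "(u - {i}) \<inter> v \<noteq> {}" "u \<inter> (v - {i}) \<noteq> {}" by auto
    then show ?thesis using assms obasis_remove[OF \<alpha>, of "{i}"] obasis_remove[OF \<beta>, of "{i}"]
      by (simp add: omult_omono oder_omono_odd oder_zero omult_zero_left omult_zero_right
          omult_scale_left omult_scale_right)
  qed
next
  case True
  define u' where "u' = u - {i}"
  define v' where "v' = v - {i}"
  define B :: 'a where "B = of_nat (bincoeff \<alpha> \<beta>)"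
  have fin: "finite u'" "finite v'" using \<alpha> \<beta> finite_idxB by (auto simp: obasis_def u'_def v'_def)
  have nin: "i \<notin> u'" "i \<notin> v'" by (auto simp: u'_def v'_def)
  have disj: "u' \<inter> v' = {}" and A: "\<alpha> + \<beta> \<in> idxA" using True by (auto simp: u'_def v'_def)
  have b: "(\<alpha>, u') \<in> obasis" "(\<beta>, v') \<in> obasis"
    using \<alpha> \<beta> by (auto simp: u'_def v'_def obasis_remove)
  have ins: "inv_sign (insert i u') w = (inv_sign {i} w * inv_sign u' w :: 'a)"
      "inv_sign w (insert i v') = (inv_sign w {i} * inv_sign w v' :: 'a)" for w
    using inv_sign_insert_left inv_sign_insert_right fin nin by metis+
  have insi: "inv_sign {i} (insert i w) = (inv_sign {i} w :: 'a)" if "finite w" "i \<notin> w" for w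
    using inv_sign_insert_right[OF that, of "{i}", where 'a = 'a] by simp
  have un: "inv_sign {i} (u' \<union> v') = (inv_sign {i} u' * inv_sign {i} v' :: 'a)"
    using fin disj by (rule inv_sign_union_right)
  have insi': "inv_sign {i} (insert i (u' \<union> v')) = (inv_sign {i} u' * inv_sign {i} v' :: 'a)"
      "inv_sign {i} (insert i u') = (inv_sign {i} u' :: 'a)"
      "inv_sign {i} (insert i v') = (inv_sign {i} v' :: 'a)"
    using fin nin by (simp_all add: insi un)
  have swap: "inv_sign u' {i} = (- 1) ^ card u' * (inv_sign {i} u' :: 'a)"
    using inv_sign_swap[of u' "{i}", where 'a = 'a] nin by simp
  have sq: "inv_sign {i} w * inv_sign {i} w = (1 :: 'a)" for w by (rule inv_sign_square)
  consider "u = insert i u'" "v = v'" | "u = u'" "v = insert i v'" | "u = insert i u'" "v = insert i v'"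
    using True unfolding u'_def v'_def by blast
  then show ?thesis
  proof cases
    case 1
    have set: "insert i u' \<inter> v' = {}" "insert i u' \<union> v' = insert i (u' \<union> v')"
        "insert i (u' \<union> v') - {i} = u' \<union> v'" "insert i u' - {i} = u'"
      using nin disj by auto
    have ob: "(\<alpha>, insert i u') \<in> obasis" "(\<alpha> + \<beta>, insert i (u' \<union> v')) \<in> obasis"
      using \<alpha> obasis_plus[OF \<alpha> \<beta> A] by (simp_all add: 1)
    have "inv_sign (insert i u') v' * inv_sign {i} (insert i (u' \<union> v'))
        = inv_sign {i} u' * inv_sign u' v' * (inv_sign {i} v' * (inv_sign {i} v' :: 'a))"
      unfolding insi' ins by (simp only: mult_ac)
    then have sgn: "inv_sign (insert i u') v' * inv_sign {i} (insert i (u' \<union> v'))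
        = (inv_sign {i} (insert i u') * inv_sign u' v' :: 'a)"
      unfolding sq insi' by simp
    have "oder i (omult (omono \<alpha> u) (omono \<beta> v)) = oscale (B * (inv_sign (insert i u') v'
        * inv_sign {i} (insert i (u' \<union> v')))) (omono (\<alpha> + \<beta>) (u' \<union> v') :: 'a oelt)"
      using b(2) ob i A set(1) unfolding 1
      by (simp add: omult_omono oder_scale set(2) oder_omono_odd set(3) B_def mult.assoc)
    also have "\<dots> = omult (oder i (omono \<alpha> u)) (omono \<beta> v)"
      unfolding sgn unfolding 1 using b ob i A disj
      by (simp add: oder_omono_odd omult_scale_left omult_omono set(4) B_def mult_ac)
    finally show ?thesis using \<beta> i nin 1 by (simp add: oder_omono_odd omult_zero_right)
  next
    case 2
    have set: "u' \<inter> insert i v' = {}" "u' \<union> insert i v' = insert i (u' \<union> v')"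
        "insert i (u' \<union> v') - {i} = u' \<union> v'" "insert i v' - {i} = v'"
      using nin disj by auto
    have ob: "(\<beta>, insert i v') \<in> obasis" "(\<alpha> + \<beta>, insert i (u' \<union> v')) \<in> obasis"
      using \<beta> obasis_plus[OF \<alpha> \<beta> A] by (simp_all add: 2)
    have "inv_sign u' (insert i v') * inv_sign {i} (insert i (u' \<union> v'))
        = (- 1) ^ card u' * (inv_sign {i} v' * inv_sign u' v') * (inv_sign {i} u' * (inv_sign {i} u' :: 'a))"
      unfolding insi' ins swap by (simp only: mult_ac)
    then have sgn: "inv_sign u' (insert i v') * inv_sign {i} (insert i (u' \<union> v'))
        = ((- 1) ^ card u' * (inv_sign {i} (insert i v') * inv_sign u' v') :: 'a)"
      unfolding sq insi' by (simp add: mult_ac)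
    have "oder i (omult (omono \<alpha> u) (omono \<beta> v)) = oscale (B * (inv_sign u' (insert i v')
        * inv_sign {i} (insert i (u' \<union> v')))) (omono (\<alpha> + \<beta>) (u' \<union> v') :: 'a oelt)"
      using b(1) ob i A set(1) unfolding 2
      by (simp add: omult_omono oder_scale set(2) oder_omono_odd set(3) B_def mult.assoc)
    also have "\<dots> = oscale ((- 1) ^ card u) (omult (omono \<alpha> u) (oder i (omono \<beta> v)))"
      unfolding sgn unfolding 2 using b ob i A disj
      by (simp add: oder_omono_odd omult_scale_right omult_omono set(4) B_def mult_ac)
    finally show ?thesis using \<alpha> i nin 2 by (simp add: oder_omono_odd omult_zero_left)
  next
    case 3
    have set: "u' \<inter> insert i v' = {}" "insert i u' \<inter> v' = {}"
        "u' \<union> insert i v' = insert i (u' \<union> v')" "insert i u' \<union> v' = insert i (u' \<union> v')"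
        "insert i v' - {i} = v'" "insert i u' - {i} = u'" "insert i u' \<inter> insert i v' \<noteq> {}"
      using nin disj by auto
    have ob: "(\<alpha>, insert i u') \<in> obasis" "(\<beta>, insert i v') \<in> obasis"
      using \<alpha> \<beta> by (simp_all add: 3)
    have "inv_sign {i} (insert i u') * inv_sign u' (insert i v')
        = (- 1) ^ card u' * inv_sign u' v' * (inv_sign {i} u' * (inv_sign {i} u' :: 'a))"
      unfolding insi' ins swap by (simp only: mult_ac)
    then have sgn1: "inv_sign {i} (insert i u') * inv_sign u' (insert i v')
        = ((- 1) ^ card u' * inv_sign u' v' :: 'a)"
      unfolding sq by simp
    have "inv_sign {i} (insert i v') * inv_sign (insert i u') v'
        = inv_sign u' v' * (inv_sign {i} v' * (inv_sign {i} v' :: 'a))"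
      unfolding insi' ins inv_sign_self by (simp only: mult_ac mult_1_left mult_1_right)
    then have sgn2: "inv_sign {i} (insert i v') * inv_sign (insert i u') v' = (inv_sign u' v' :: 'a)"
      unfolding sq by simp
    define M where "M = oscale B (omono (\<alpha> + \<beta>) (insert i (u' \<union> v')))"
    have "omult (oder i (omono \<alpha> u)) (omono \<beta> v)
        = oscale (inv_sign {i} (insert i u') * inv_sign u' (insert i v')) M"
      unfolding 3 using b ob i A set(1)
      by (simp add: oder_omono_odd omult_scale_left omult_omono set(3,6) B_def M_def mult_ac)
    moreover have "omult (omono \<alpha> u) (oder i (omono \<beta> v))
        = oscale (inv_sign {i} (insert i v') * inv_sign (insert i u') v') M"
      unfolding 3 using b ob i A set(2)
      by (simp add: oder_omono_odd omult_scale_right omult_omono set(4,5) B_def M_def mult_ac)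
    moreover have "omult (omono \<alpha> u) (omono \<beta> v) = (0 :: 'a oelt)"
      unfolding 3 using ob set(7) by (simp add: omult_omono)
    moreover have "card u = Suc (card u')" using 3(1) fin nin by simp
    ultimately show ?thesis unfolding sgn1 sgn2 by (simp add: oder_zero)
  qed
qed

lemma oder_omult:
  fixes f g :: "'a oelt"
  assumes f: "f \<in> osuper" "f \<in> ohomog r" and g: "g \<in> osuper" and i: "i \<in> Y"
  shows "oder i (omult f g) = omult (oder i f) g + oscale ((- 1) ^ (mu i * r)) (omult f (oder i g))"
  using f(1)
proof (induction f rule: osuper_induct)
  case (mono c \<alpha> u)
  have "card u mod 2 = r mod 2" using mono(2) f(2) unfolding ohomog_def by blast
  then have sgn: "(- 1 :: 'a) ^ card u = (- 1) ^ r"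
    by (simp add: minus_one_power_iff even_iff_mod_2_eq_zero)
  have u: "(\<alpha>, u) \<in> obasis" by (rule mono(1))
  show ?case using g
  proof (induction g rule: osuper_induct)
    case (mono d \<beta> v)
    have "oder i (omult (omono \<alpha> u) (omono \<beta> v)) = omult (oder i (omono \<alpha> u)) (omono \<beta> v)
        + oscale ((- 1) ^ (mu i * r)) (omult (omono \<alpha> u) (oder i (omono \<beta> v) :: 'a oelt))"
      using i oder_omult_omono_even[OF u mono(1)] oder_omult_omono_odd[OF u mono(1)] sgn
      by (auto simp: Y_def mu_Y0 mu_Y1)
    then show ?case
      by (simp add: omult_scale_left omult_scale_right oder_scale ospace.scale_right_distrib mult_ac)
  qed (simp_all add: oder_zero oder_add omult_zero_right omult_add_right ospace.scale_right_distrib)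
qed (simp_all add: oder_zero oder_add omult_zero_left omult_add_left ospace.scale_right_distrib)

text \<open>
  Only two distinct odd derivatives produce a sign: removing \<open>x\<^sub>i\<close> before \<open>x\<^sub>j\<close> or after it differs by
  the transposition of the two.
\<close>

lemma oder_commute:
  fixes f :: "'a oelt"
  assumes "f \<in> osuper" "i \<in> Y" "j \<in> Y"
  shows "oder i (oder j f) = oscale ((- 1) ^ (mu i * mu j)) (oder j (oder i f))"
  using assms(1)
proof (induction f rule: osuper_induct)
  case (mono c \<alpha> u)
  have fin: "finite u" using mono(1) finite_idxB by (auto simp: obasis_def)
  note lower = obasis_lower[OF mono(1)] and remove = obasis_remove[OF mono(1)]
  have "oder i (oder j (omono \<alpha> u)) = oscale ((- 1) ^ (mu i * mu j)) (oder j (oder i (omono \<alpha> u) :: 'a oelt))"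
  proof (cases "i = j")
    case True
    then show ?thesis using assms(2) mono(1) remove
      by (auto simp: Y_def mu_Y0 mu_Y1 oder_omono_odd oder_scale oder_zero)
  next
    case False
    have swap: "\<alpha> - unit_idx i - unit_idx j = \<alpha> - unit_idx j - unit_idx i"
      by (auto simp: fun_eq_iff minus_apply)
    have low: "(\<alpha> - unit_idx i) j = \<alpha> j" "(\<alpha> - unit_idx j) i = \<alpha> i"
      using False by (auto simp: unit_idx_def minus_apply)
    have sgn: "inv_sign {i} u * inv_sign {j} (u - {i}) = - (inv_sign {j} u * (inv_sign {i} (u - {j}) :: 'a))"
      if "i \<in> u" "j \<in> u"
    proof -
      define w where "w = u - {i, j}"
      have w: "u = insert i (insert j w)" "u - {i} = insert j w" "u - {j} = insert i w"
        "i \<notin> w" "j \<notin> w" "finite w"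
        using that False fin by (auto simp: w_def)
      have "inv_sign {i} {j} = - (inv_sign {j} {i} :: 'a)"
        using inv_sign_swap[of "{i}" "{j}", where 'a = 'a] False by simp
      moreover have ins: "inv_sign {k} (insert l w) = (inv_sign {k} {l} * inv_sign {k} w :: 'a)"
        if "l \<notin> w" for k l
        using w(6) that by (rule inv_sign_insert_right)
      moreover have "inv_sign {i} u = (inv_sign {i} {i} * inv_sign {i} (insert j w) :: 'a)"
        unfolding w(1) using w(4-6) False by (intro inv_sign_insert_right) auto
      moreover have "inv_sign {j} u = (inv_sign {j} {j} * inv_sign {j} (insert i w) :: 'a)"
        unfolding w(1) insert_commute[of i j w] using w(4-6) False by (intro inv_sign_insert_right) auto
      ultimately show ?thesis
        unfolding w(2,3) using w(4,5) by simp
    qed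
    have rem: "u - {i} - {j} = u - {j} - {i}" by auto
    have "i \<in> Y0 \<or> i \<in> Y1" "j \<in> Y0 \<or> j \<in> Y1" using assms(2,3) by (auto simp: Y_def)
    then show ?thesis
      using mono(1) remove lower False sgn
      by (auto simp: mu_Y0 mu_Y1 oder_omono_odd oder_omono_even oder_scale oder_zero swap low rem mult_ac)
  qed
  then show ?case by (simp add: oder_scale mult.commute)
qed (simp_all add: oder_zero oder_add ospace.scale_right_distrib)

end

section \<open>The even part of the Witt superalgebra\<close>

lemma ohomog_cong: "r mod 2 = s mod 2 \<Longrightarrow> ohomog r = ohomog s"
  by (simp add: ohomog_def)

lemma sum_welt_apply: "(\<Sum>x\<in>S. (F x :: 'a::field welt)) k = (\<Sum>x\<in>S. F x k)"
  by (induction S rule: infinite_finite_induct) (auto simp: zero_fun_apply plus_fun_apply)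

lemma wscale_apply: "wscale c D i = oscale c (D i)"
  by (simp add: wscale_def)

lemma lie_algebra_subalgebra:
  assumes "lie_algebra scale L br" "module.subspace scale K" "K \<subseteq> L"
    and "\<And>x y. x \<in> K \<Longrightarrow> y \<in> K \<Longrightarrow> br x y \<in> K"
  shows "lie_algebra scale K br"
proof -
  interpret lie_algebra scale L br by fact
  note K = subsetD[OF assms(3)]
  show ?thesis
    by unfold_locales
      (simp_all add: assms(2,4) K br_add_left br_add_right br_scale_left br_scale_right br_self jacobi)
qed

context modular_superalgebra
begin

text \<open>
  The derivation \<open>a \<partial>\<^sub>i\<close> is even if and only if \<open>a\<close> and \<open>\<partial>\<^sub>i\<close> have the same parity.
\<close>

definition even_witt :: "'a welt set"
  where "even_witt = {D \<in> witt. \<forall>i\<in>Y. D i \<in> ohomog (mu i)}"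

lemma even_witt_D:
  assumes "D \<in> even_witt"
  shows "i \<in> Y \<Longrightarrow> D i \<in> osuper" "i \<in> Y \<Longrightarrow> D i \<in> ohomog (mu i)" "i \<notin> Y \<Longrightarrow> D i = 0"
  using assms by (auto simp: even_witt_def witt_def)

lemma wact_add: "wact D (f + g) = wact D f + wact D g"
  and wact_diff: "wact D (f - g) = wact D f - wact D g"
  and wact_scale: "wact D (oscale c f) = oscale c (wact D f)"
  and wact_sum: "wact D (\<Sum>x\<in>S. F x) = (\<Sum>x\<in>S. wact D (F x))"
  by (simp_all add: wact_def oder_zero oder_add oder_diff oder_scale oder_sum omult_zero_right
      omult_add_right omult_diff_right omult_scale_right omult_sum_right sum.distrib sum_subtractf
      ospace.scale_sum_right sum.swap[of _ S])

lemma wact_add_left: "wact (D + E) f = wact D f + wact E f"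
  and wact_scale_left: "wact (wscale c D) f = oscale c (wact D f)"
  by (simp_all add: wact_def plus_fun_apply wscale_def omult_add_left omult_scale_left sum.distrib
      ospace.scale_sum_right)

lemma wact_osuper: "D \<in> even_witt \<Longrightarrow> f \<in> osuper \<Longrightarrow> wact D f \<in> osuper"
  unfolding wact_def by (simp add: osuper_sum omult_osuper oder_osuper even_witt_D(1))

lemma wact_ohomog:
  assumes "D \<in> even_witt" "f \<in> osuper" "f \<in> ohomog r"
  shows "wact D f \<in> ohomog r"
proof -
  have "omult (D i) (oder i f) \<in> ohomog r" if i: "i \<in> Y" for i
  proof -
    have "omult (D i) (oder i f) \<in> ohomog (mu i + (mu i + r))"
      by (intro omult_ohomog oder_osuper oder_ohomog even_witt_D[OF assms(1)] assms i)
    moreover have "(mu i + (mu i + r)) mod 2 = r mod 2" by presburger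
    ultimately show ?thesis using ohomog_cong by blast
  qed
  then show ?thesis unfolding wact_def by (rule ohomog_sum)
qed

text \<open>
  An even superderivation is an ordinary derivation: the sign in the Leibniz rule of \<open>\<partial>\<^sub>i\<close> is
  compensated by the one from moving the coefficient \<open>D i\<close>, of the same parity as \<open>\<partial>\<^sub>i\<close>, past \<open>f\<close>.
\<close>

lemma wact_omult:
  assumes D: "D \<in> even_witt" and f: "f \<in> osuper" "f \<in> ohomog r" and g: "g \<in> osuper"
  shows "wact D (omult f g) = omult (wact D f) g + omult f (wact D g)"
proof -
  have "omult (D i) (oder i (omult f g)) = omult (omult (D i) (oder i f)) g + omult f (omult (D i) (oder i g))"
    if i: "i \<in> Y" for i
  proof -
    note Di = even_witt_D(1,2)[OF D i]
    note df = oder_osuper[OF f(1) i] and dg = oder_osuper[OF g i]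
    have "omult (D i) (omult f (oder i g)) = oscale ((- 1) ^ (mu i * r)) (omult f (omult (D i) (oder i g)))"
      using omult_supercommute[OF Di f] omult_assoc[OF Di(1) f(1) dg] omult_assoc[OF f(1) Di(1) dg]
      by (metis omult_scale_left)
    then show ?thesis
      using omult_assoc[OF Di(1) df g]
      by (simp add: oder_omult[OF f g i] omult_add_right omult_scale_right)
  qed
  then show ?thesis
    by (simp add: wact_def sum.distrib omult_sum_left omult_sum_right)
qed

text \<open>
  In the commutator of two vector fields the second derivatives cancel: \<open>E\<^sub>j D\<^sub>i \<partial>\<^sub>i \<partial>\<^sub>j\<close> equals
  \<open>D\<^sub>i E\<^sub>j \<partial>\<^sub>j \<partial>\<^sub>i\<close> because the signs of swapping the coefficients and of swapping the derivatives
  agree.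
\<close>

lemma wact_commutator:
  assumes D: "D \<in> even_witt" and E: "E \<in> even_witt" and f: "f \<in> osuper"
  shows "(\<Sum>j\<in>Y. omult (wact D (E j) - wact E (D j)) (oder j f)) = wact D (wact E f) - wact E (wact D f)"
proof -
  have expand: "wact D (wact E f) = (\<Sum>j\<in>Y. omult (wact D (E j)) (oder j f))
      + (\<Sum>j\<in>Y. \<Sum>i\<in>Y. omult (E j) (omult (D i) (oder i (oder j f))))"
    if D: "D \<in> even_witt" and E: "E \<in> even_witt" for D E
  proof -
    have "wact D (wact E f) = (\<Sum>j\<in>Y. wact D (omult (E j) (oder j f)))"
      by (subst (2) wact_def) (rule wact_sum)
    also have "\<dots> = (\<Sum>j\<in>Y. omult (wact D (E j)) (oder j f) + omult (E j) (wact D (oder j f)))"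
      using wact_omult[OF D even_witt_D(1,2)[OF E] oder_osuper[OF f]] by (intro sum.cong) simp_all
    finally show ?thesis by (simp add: sum.distrib wact_def omult_sum_right)
  qed
  have sym: "omult (E j) (omult (D i) (oder i (oder j f))) = omult (D i) (omult (E j) (oder j (oder i f)))"
    if i: "i \<in> Y" and j: "j \<in> Y" for i j
  proof -
    note Di = even_witt_D(1,2)[OF D i] and Ej = even_witt_D(1,2)[OF E j]
    have fji: "oder j (oder i f) \<in> osuper" by (intro oder_osuper f i j)
    have "omult (E j) (omult (D i) (oder i (oder j f)))
        = oscale ((- 1) ^ (mu i * mu j)) (omult (omult (E j) (D i)) (oder j (oder i f)))"
      by (simp add: oder_commute[OF f i j] omult_scale_right omult_assoc[OF Ej(1) Di(1) fji])
    also have "\<dots> = omult (omult (D i) (E j)) (oder j (oder i f))"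
      by (simp add: omult_supercommute[OF Ej Di] omult_scale_left mult.commute)
    finally show ?thesis by (simp only: omult_assoc[OF Di(1) Ej(1) fji])
  qed
  have "(\<Sum>j\<in>Y. \<Sum>i\<in>Y. omult (E j) (omult (D i) (oder i (oder j f))))
      = (\<Sum>j\<in>Y. \<Sum>i\<in>Y. omult (D i) (omult (E j) (oder j (oder i f))))"
    by (intro sum.cong refl sym)
  also have "\<dots> = (\<Sum>i\<in>Y. \<Sum>j\<in>Y. omult (D i) (omult (E j) (oder j (oder i f))))"
    by (rule sum.swap)
  finally show ?thesis
    by (simp add: expand[OF D E] expand[OF E D] omult_diff_left sum_subtractf)
qed

lemma wbr_single_zero: "wbr_single i r 0 j s b = 0" "wbr_single i r a j s 0 = 0"
  by (auto simp: wbr_single_def wsingle_def wscale_def omult_zero_left omult_zero_right oder_zero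
      fun_eq_iff minus_apply zero_fun_apply oscale_apply)

text \<open>
  For even \<open>D\<close> and \<open>E\<close> only the summands with \<open>r = \<mu>(i)\<close> and \<open>s = \<mu>(j)\<close> of the superbracket survive, and
  there its sign is trivial. What remains is the usual coordinate formula for the commutator of
  vector fields.
\<close>

lemma wbr_even:
  assumes D: "D \<in> even_witt" and E: "E \<in> even_witt"
  shows "wbr D E k = (if k \<in> Y then wact D (E k) - wact E (D k) else 0)"
proof -
  have single: "(\<Sum>r\<in>{0, 1}. \<Sum>s\<in>{0, 1}. wbr_single i r (opart r (D i)) j s (opart s (E j)))
      = wsingle j (omult (D i) (oder i (E j))) - wsingle i (omult (E j) (oder j (D i)))"
    if ij: "i \<in> Y" "j \<in> Y" for i j
  proof -
    have mu: "mu k = 0 \<or> mu k = 1" for k by (simp add: mu_def)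
    have "opart r (D i) = (if r = mu i then D i else 0)" "opart r (E j) = (if r = mu j then E j else 0)"
      if "r \<in> {0, 1}" for r
    proof -
      have "r < 2" "mu k mod 2 = mu k" for k using that by (auto simp: mu_def)
      then show "opart r (D i) = (if r = mu i then D i else 0)" "opart r (E j) = (if r = mu j then E j else 0)"
        using opart_ohomog[OF even_witt_D(2)[OF D ij(1)]] opart_ohomog[OF even_witt_D(2)[OF E ij(2)]]
        by simp_all
    qed
    then have "wbr_single i r (opart r (D i)) j s (opart s (E j))
        = (if r = mu i then if s = mu j then wbr_single i (mu i) (D i) j (mu j) (E j) else 0 else 0)"
      if "r \<in> {0, 1}" "s \<in> {0, 1}" for r s
      using that by (simp add: wbr_single_zero)
    then have "(\<Sum>r\<in>{0, 1}. \<Sum>s\<in>{0, 1}. wbr_single i r (opart r (D i)) j s (opart s (E j)))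
        = (\<Sum>r\<in>{0, 1}. \<Sum>s\<in>{0, 1}. if r = mu i then if s = mu j
            then wbr_single i (mu i) (D i) j (mu j) (E j) else 0 else 0)"
      by (intro sum.cong refl)
    also have "\<dots> = wbr_single i (mu i) (D i) j (mu j) (E j)"
    proof -
      consider "mu i = 0" "mu j = 0" | "mu i = 0" "mu j = 1" | "mu i = 1" "mu j = 0" | "mu i = 1" "mu j = 1"
        using mu[of i] mu[of j] by meson
      then show ?thesis by cases simp_all
    qed
    also have "\<dots> = wsingle j (omult (D i) (oder i (E j))) - wsingle i (omult (E j) (oder j (D i)))"
    proof -
      have "even ((mu i + mu i) * (mu j + mu j))" by simp
      then show ?thesis by (simp add: wbr_single_def minus_one_power_iff)
    qed
    finally show ?thesis .
  qed
  have "wbr D E = (\<Sum>i\<in>Y. \<Sum>j\<in>Y.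
      wsingle j (omult (D i) (oder i (E j))) - wsingle i (omult (E j) (oder j (D i))))"
    unfolding wbr_def by (intro sum.cong refl single)
  then have "wbr D E k = (\<Sum>i\<in>Y. \<Sum>j\<in>Y.
      (wsingle j (omult (D i) (oder i (E j))) - wsingle i (omult (E j) (oder j (D i)))) k)"
    by (simp only: sum_welt_apply)
  also have "\<dots> = (\<Sum>i\<in>Y. \<Sum>j\<in>Y. (if k = j then omult (D i) (oder i (E k)) else 0)
      - (if k = i then omult (E j) (oder j (D k)) else 0))"
    by (intro sum.cong refl) (auto simp: minus_apply wsingle_def)
  also have "\<dots> = (\<Sum>i\<in>Y. \<Sum>j\<in>Y. if k = j then omult (D i) (oder i (E k)) else 0)
      - (\<Sum>i\<in>Y. \<Sum>j\<in>Y. if k = i then omult (E j) (oder j (D k)) else 0)"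
    by (simp only: sum_subtractf)
  also have "(\<Sum>i\<in>Y. \<Sum>j\<in>Y. if k = i then omult (E j) (oder j (D k)) else 0)
      = (\<Sum>j\<in>Y. \<Sum>i\<in>Y. if k = i then omult (E j) (oder j (D k)) else 0)"
    by (rule sum.swap)
  finally show ?thesis by (simp add: finite_Y wact_def)
qed

lemma even_witt_subspace: "wspace.subspace even_witt"
  by (rule wspace.subspaceI)
     (auto simp: even_witt_def witt_def zero_fun_apply plus_fun_apply wscale_def osuper_zero
       ohomog_zero osuper_add ohomog_add osuper_scale ohomog_scale)

lemma wbr_even_witt:
  assumes "D \<in> even_witt" "E \<in> even_witt"
  shows "wbr D E \<in> even_witt"
  unfolding even_witt_def witt_def using assms
  by (auto simp: wbr_even intro!: osuper_diff ohomog_diff wact_osuper wact_ohomog dest: even_witt_D)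

lemma wact_wbr:
  assumes "D \<in> even_witt" "E \<in> even_witt" "f \<in> osuper"
  shows "wact (wbr D E) f = wact D (wact E f) - wact E (wact D f)"
  using wact_commutator[OF assms] assms(1,2) by (simp add: wact_def[of "wbr D E"] wbr_even)

lemma lie_algebra_even_witt: "lie_algebra wscale even_witt wbr"
proof
  fix D E F :: "'a welt" and c :: 'a
  assume D: "D \<in> even_witt" and E: "E \<in> even_witt"
  show "wbr D E \<in> even_witt" using D E by (rule wbr_even_witt)
  have cD: "wscale c D \<in> even_witt" and cE: "wscale c E \<in> even_witt"
    using D E by (simp_all add: wspace.subspace_scale[OF even_witt_subspace])
  show "wbr (wscale c D) E = wscale c (wbr D E)"
    using D E cD by (auto simp: fun_eq_iff[where f = "wbr _ _"] wbr_even wact_scale_left wscale_apply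
        wact_scale ospace.scale_right_diff_distrib)
  show "wbr D (wscale c E) = wscale c (wbr D E)"
    using D E cE by (auto simp: fun_eq_iff[where f = "wbr _ _"] wbr_even wact_scale_left wscale_apply
        wact_scale ospace.scale_right_diff_distrib)
  show "wbr D D = 0"
    using D by (auto simp: fun_eq_iff[where f = "wbr _ _"] wbr_even zero_fun_apply)
  assume F: "F \<in> even_witt"
  have DE: "D + E \<in> even_witt" and EF: "E + F \<in> even_witt"
    using D E F by (simp_all add: wspace.subspace_add[OF even_witt_subspace])
  show "wbr (D + E) F = wbr D F + wbr E F"
    using D E F DE by (auto simp: fun_eq_iff[where f = "wbr _ _"] wbr_even wact_add_left wact_add plus_fun_apply)
  show "wbr D (E + F) = wbr D E + wbr D F"
    using D E F EF by (auto simp: fun_eq_iff[where f = "wbr _ _"] wbr_even wact_add_left wact_add plus_fun_apply)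
  have "wbr D (wbr E F) k + wbr E (wbr F D) k + wbr F (wbr D E) k = 0" for k
    using D E F
    by (simp add: wbr_even wbr_even_witt wact_wbr wact_diff even_witt_D)
  then show "wbr D (wbr E F) + wbr E (wbr F D) + wbr F (wbr D E) = 0"
    by (intro ext[where f = "_ + _"]) (simp add: plus_fun_apply zero_fun_apply)
qed (rule even_witt_subspace)

end

section \<open>Hamiltonian vector fields and the Poisson bracket\<close>

context superalgebra_params
begin

definition oeven :: "'a::field oelt set"
  where "oeven = osuper \<inter> ohomog 0"

text \<open>
  This is \<open>D_H(f)(g)\<close> for even \<open>f\<close> (lemma \<open>wact_DH\<close>). For odd \<open>f\<close> the sign \<open>(-1)^\<mu>(i)\<close> of \<open>D_H\<close> would
  have to be added.
\<close>

definition poisson :: "'a::field oelt \<Rightarrow> 'a oelt \<Rightarrow> 'a oelt"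
  where "poisson f g = (\<Sum>i\<in>Y. oscale (tau i) (omult (oder i f) (oder (conj_idx i) g)))"

lemma conj_idx_Y0: "i \<in> Y0 \<Longrightarrow> conj_idx i \<in> Y0"
  and conj_idx_Y1: "i \<in> Y1 \<Longrightarrow> conj_idx i = i"
  by (auto simp: conj_idx_def Y0_def Y1_def)

lemma conj_idx_Y: "i \<in> Y \<Longrightarrow> conj_idx i \<in> Y"
  and conj_idx_conj_idx: "i \<in> Y \<Longrightarrow> conj_idx (conj_idx i) = i"
  by (auto simp: conj_idx_def Y_def Y0_def Y1_def)

lemma mu_conj_idx: "i \<in> Y \<Longrightarrow> mu (conj_idx i) = mu i"
  by (auto simp: conj_idx_def Y_def Y0_def Y1_def mu_def)

text \<open>
  This uniform sign rule is what makes the Poisson bracket of even elements antisymmetric: for even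
  indices the sign comes from \<open>\<tau>\<close>, for odd ones from exchanging two odd derivatives.
\<close>

lemma tau_conj_idx: "i \<in> Y \<Longrightarrow> tau (conj_idx i) * (- 1) ^ mu i = - (tau i :: 'a::field)"
  by (auto simp: tau_def conj_idx_def Y_def Y0_def Y1_def mu_def)

lemma sum_conj_idx: "(\<Sum>i\<in>Y. F (conj_idx i)) = (\<Sum>i\<in>Y. F i)"
  by (rule sum.reindex_bij_witness[of _ conj_idx conj_idx])
     (simp_all add: conj_idx_Y conj_idx_conj_idx)

lemma sum_Y0_pairs: "(\<Sum>i\<in>Y0. F i) = (\<Sum>i\<in>{1..m}. F i + F (conj_idx i))"
proof -
  have "(\<Sum>i\<in>Y0. F i) = sum F {1..m} + sum F {m + 1..m + m}"
    unfolding Y0_def mult_2 by (rule sum.ub_add_nat) simp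
  also have "sum F {m + 1..m + m} = (\<Sum>i\<in>{1..m}. F (i + m))"
    using sum.shift_bounds_cl_nat_ivl[of F 1 m m] by (simp add: add.commute)
  finally show ?thesis
    by (simp add: sum.distrib conj_idx_def)
qed

lemma opart_add: "opart r (f + g) = opart r f + opart r g"
  and opart_scale: "opart r (oscale c f) = oscale c (opart r f)"
  by (auto simp: opart_def fun_eq_iff plus_fun_apply oscale_apply)

lemma wsingle_zero: "wsingle i 0 = 0"
  and wsingle_add: "wsingle i (a + b) = wsingle i a + wsingle i b"
  and wsingle_scale: "wsingle i (oscale c a) = wscale c (wsingle i a)"
  by (auto simp: wsingle_def fun_eq_iff plus_fun_apply wscale_apply oscale_apply zero_fun_apply)

lemma DH_add: "DH (f + g) = DH f + DH g"
  by (simp add: DH_def opart_add oder_add wsingle_add wspace.scale_right_distrib sum.distrib)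

lemma DH_scale: "DH (oscale c f) = wscale c (DH f)"
  by (simp add: DH_def opart_scale oder_scale wsingle_scale wspace.scale_right_distrib
      wspace.scale_sum_right mult_ac)

lemma DH_module_hom: "module_hom oscale wscale DH"
  by (simp add: module_hom_def module_hom_axioms_def ospace.module_axioms wspace.module_axioms
      DH_add DH_scale)

lemma DH_apply:
  assumes "f \<in> oeven"
  shows "DH f k = (if k \<in> Y then oscale (tau (conj_idx k)) (oder (conj_idx k) f) else 0)"
proof -
  have "opart 0 f = f" "opart 1 f = 0"
    using assms opart_ohomog[of f 0] by (auto simp: oeven_def)
  then have "DH f k = (\<Sum>i\<in>Y. wscale (tau i) (wsingle (conj_idx i) (oder i f)) k)"
    by (simp add: DH_def plus_fun_apply oder_zero wsingle_zero sum_welt_apply zero_fun_apply)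
  also have "\<dots> = (\<Sum>i\<in>Y. if i = conj_idx k \<and> k \<in> Y then oscale (tau i) (oder i f) else 0)"
    by (intro sum.cong refl)
       (auto simp: wscale_apply wsingle_def conj_idx_conj_idx conj_idx_Y)
  also have "\<dots> = (if k \<in> Y then oscale (tau (conj_idx k)) (oder (conj_idx k) f) else 0)"
    by (simp add: finite_Y conj_idx_Y)
  finally show ?thesis .
qed

lemma wact_DH:
  assumes "f \<in> oeven"
  shows "wact (DH f) g = poisson f g"
proof -
  have "wact (DH f) g = (\<Sum>k\<in>Y. oscale (tau (conj_idx k)) (omult (oder (conj_idx k) f) (oder k g)))"
    by (simp add: wact_def DH_apply[OF assms] omult_scale_left)
  also have "\<dots> = (\<Sum>k\<in>Y. oscale (tau (conj_idx k)) (omult (oder (conj_idx k) f) (oder (conj_idx (conj_idx k)) g)))"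
    by (intro sum.cong refl) (simp add: conj_idx_conj_idx)
  also have "\<dots> = poisson f g"
    unfolding poisson_def
    by (rule sum_conj_idx[of "\<lambda>i. oscale (tau i) (omult (oder i f) (oder (conj_idx i) g))"])
  finally show ?thesis .
qed

text \<open>
  A monomial with exponent \<open>\<pi>\<^sub>i\<close> at \<open>i\<close> could only be the derivative of one with exponent \<open>\<pi>\<^sub>i + 1\<close>.
\<close>

lemma oder_top_even:
  fixes f :: "'a::field oelt"
  assumes "i \<in> Y0"
  shows "oder i f (top_idx, w) = 0"
proof -
  have "bder i b (top_idx, w) = (0 :: 'a)" if "b \<in> obasis" for b
  proof -
    have "top_idx \<noteq> fst b - unit_idx i" if "fst b i \<noteq> 0"
    proof
      assume "top_idx = fst b - unit_idx i"
      then have "top_idx i = fst b i - 1" by (simp add: unit_idx_def minus_apply)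
      moreover have "fst b i \<le> top_idx i" using \<open>b \<in> obasis\<close> assms by (auto simp: obasis_def idxA_def)
      ultimately show False using \<open>fst b i \<noteq> 0\<close> by linarith
    qed
    moreover have "bder i b = (if fst b i = 0 then 0 else omono (fst b - unit_idx i) (snd b) :: 'a oelt)"
      using assms by (cases b) (simp add: bder_def)
    ultimately show ?thesis by (simp add: omono_def zero_fun_apply)
  qed
  then show ?thesis by (simp add: oder_def sum_oelt_apply oscale_apply)
qed

lemma oder_top_odd:
  fixes f :: "'a::field oelt"
  assumes "i \<in> Y1"
  shows "oder i f (\<alpha>, Y1) = 0"
proof -
  have "bder i b (\<alpha>, Y1) = (0 :: 'a)" for b
    using assms Y0_disjoint_Y1 by (cases b) (auto simp: bder_def omono_def oscale_apply zero_fun_apply)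
  then show ?thesis by (simp add: oder_def sum_oelt_apply oscale_apply)
qed

lemma oder_odd_square:
  assumes "i \<in> Y1" "f \<in> osuper"
  shows "oder i (oder i f) = 0"
  using assms(2)
proof (induction f rule: osuper_induct)
  case (mono c \<alpha> u)
  then show ?case using assms(1)
    by (simp add: oder_scale oder_omono_odd oder_zero obasis_remove)
qed (simp_all add: oder_zero oder_add)

text \<open>
  Every monomial of an odd element contains an odd variable, and so does every multiple of it.
\<close>

lemma omult_odd_empty:
  fixes f g :: "'a::field oelt"
  assumes "f \<in> osuper" "f \<in> ohomog 1" "g \<in> osuper"
  shows "omult f g (\<alpha>, {}) = 0"
  using assms(1)
proof (induction f rule: osuper_induct)
  case (mono c \<beta> u)
  have u: "u \<noteq> {}" using mono(2) assms(2) unfolding ohomog_def by force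
  note b = mono(1)
  show ?case using assms(3)
  proof (induction g rule: osuper_induct)
    case (mono d \<gamma> v)
    have z: "omult (omono \<beta> u) (omono \<gamma> v) (\<alpha>, {}) = (0 :: 'a)"
      unfolding omult_omono[OF b mono(1)] using u by (simp add: oscale_apply omono_def zero_fun_apply)
    show ?case
      by (simp only: omult_scale_left omult_scale_right) (simp only: oscale_apply z mult_zero_right)
  qed (unfold omult_zero_right omult_add_right, simp_all add: zero_fun_apply plus_fun_apply)
qed (unfold omult_zero_left omult_add_left, simp_all add: zero_fun_apply plus_fun_apply)

definition osupported :: "bidx set \<Rightarrow> 'a::field oelt set"
  where "osupported C = {f. \<forall>b. b \<notin> C \<longrightarrow> f b = 0}"

text \<open>
  The spans that define \<open>\<H>\<close> and \<open>\<NN>\<close> are images of coordinate subspaces under \<open>D_H\<close>, so membership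
  in them becomes a condition on coefficients.
\<close>

lemma span_omono:
  assumes "C \<subseteq> obasis"
  shows "ospace.span ((\<lambda>(\<alpha>, u). omono \<alpha> u) ` C) = (osupported C :: 'a::field oelt set)"
proof
  have "ospace.subspace (osupported C :: 'a oelt set)"
    by (rule ospace.subspaceI) (auto simp: osupported_def zero_fun_apply plus_fun_apply oscale_apply)
  then show "ospace.span ((\<lambda>(\<alpha>, u). omono \<alpha> u) ` C) \<subseteq> (osupported C :: 'a oelt set)"
    by (intro ospace.span_minimal) (auto simp: osupported_def omono_def)
  show "(osupported C :: 'a oelt set) \<subseteq> ospace.span ((\<lambda>(\<alpha>, u). omono \<alpha> u) ` C)"
  proof
    fix f :: "'a oelt"
    assume f: "f \<in> osupported C"
    then have "f \<in> osuper" using assms by (auto simp: osupported_def osuper_def)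
    then have "f = (\<Sum>b\<in>obasis. oscale (f b) (omono (fst b) (snd b)))"
      by (rule sum_oscale_omono[symmetric])
    also have "\<dots> \<in> ospace.span ((\<lambda>(\<alpha>, u). omono \<alpha> u) ` C)"
    proof (rule ospace.span_sum)
      fix b assume "b \<in> obasis"
      show "oscale (f b) (omono (fst b) (snd b)) \<in> ospace.span ((\<lambda>(\<alpha>, u). omono \<alpha> u) ` C)"
      proof (cases "b \<in> C")
        case True
        then have "omono (fst b) (snd b) \<in> (\<lambda>(\<alpha>, u). omono \<alpha> u :: 'a oelt) ` C"
          by (auto simp: image_iff case_prod_beta)
        then show ?thesis by (intro ospace.span_scale ospace.span_base)
      next
        case False
        then have "f b = 0" using f unfolding osupported_def by blast
        then show ?thesis by (simp add: ospace.span_zero)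
      qed
    qed
    finally show "f \<in> ospace.span ((\<lambda>(\<alpha>, u). omono \<alpha> u) ` C)" .
  qed
qed

lemma span_DH_omono:
  assumes "C \<subseteq> obasis"
  shows "wspace.span {DH (omono \<alpha> u) |\<alpha> u. (\<alpha>, u) \<in> C} = DH ` (osupported C :: 'a::field oelt set)"
proof -
  interpret module_hom oscale wscale "DH :: 'a oelt \<Rightarrow> 'a welt" by (rule DH_module_hom)
  have "{DH (omono \<alpha> u) |\<alpha> u. (\<alpha>, u) \<in> C} = DH ` (\<lambda>(\<alpha>, u). omono \<alpha> u :: 'a oelt) ` C" by force
  then show ?thesis by (simp only: span_image span_omono[OF assms])
qed

lemma oeven_conv: "oeven = osupported (idxA \<times> idxB_even)"
proof -
  have "f \<in> oeven \<longleftrightarrow> f \<in> osupported (idxA \<times> idxB_even)" for f :: "'a oelt"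
    by (simp add: oeven_def osupported_def osuper_def ohomog_def obasis_def idxB_even_def
        flip: even_iff_mod_2_eq_zero) blast
  then show ?thesis by blast
qed

lemma ham_even_conv: "ham_even = DH ` {f \<in> oeven. f (top_idx, Y1) = 0}"
proof -
  let ?C = "idxA \<times> idxB_even - {(top_idx, Y1)}"
  have "?C \<subseteq> obasis" by (auto simp: obasis_def idxB_even_def)
  from span_DH_omono[OF this]
  have "ham_even = DH ` (osupported ?C :: 'a oelt set)" unfolding ham_even_def by (simp add: conj_assoc)
  also have "osupported ?C = {f \<in> oeven. f (top_idx, Y1) = (0 :: 'a)}"
    unfolding oeven_conv osupported_def by auto
  finally show ?thesis .
qed

lemma ham_N_conv: "ham_N = DH ` {f \<in> oeven. f (top_idx, Y1) = 0 \<and> f (top_idx, {}) = 0}"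
proof -
  let ?C = "idxA \<times> idxB_even - {(top_idx, Y1), (top_idx, {})}"
  have "?C \<subseteq> obasis" by (auto simp: obasis_def idxB_even_def)
  from span_DH_omono[OF this]
  have "ham_N = DH ` (osupported ?C :: 'a oelt set)" unfolding ham_N_def by (simp add: conj_assoc)
  also have "osupported ?C = {f \<in> oeven. f (top_idx, Y1) = (0 :: 'a) \<and> f (top_idx, {}) = 0}"
    unfolding oeven_conv osupported_def by auto
  finally show ?thesis .
qed

end

context modular_superalgebra
begin

lemma DH_even_witt:
  fixes f :: "'a oelt"
  assumes "f \<in> oeven"
  shows "DH f \<in> even_witt"
proof -
  have "oder (conj_idx i) f \<in> ohomog (mu i)" if "i \<in> Y" for i
    using oder_ohomog[of f 0 "conj_idx i"] assms that by (simp add: oeven_def conj_idx_Y mu_conj_idx)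
  then show ?thesis
    using assms by (auto simp: even_witt_def witt_def DH_apply conj_idx_Y oeven_def
        intro!: osuper_scale ohomog_scale oder_osuper)
qed

lemma poisson_oeven:
  fixes f g :: "'a oelt"
  assumes "f \<in> oeven" "g \<in> oeven"
  shows "poisson f g \<in> oeven"
  using wact_osuper[OF DH_even_witt[OF assms(1)]] wact_ohomog[OF DH_even_witt[OF assms(1)]] assms
  by (simp add: oeven_def wact_DH)

text \<open>
  The derivative of \<open>\<partial>\<^sub>i f \<partial>\<^bsub>i'\<^esub> g\<close> has a term in which \<open>g\<close> is differentiated once more; these terms add
  up to \<open>{f, \<partial>\<^sub>j g}\<close>. In the other terms the factors are exchanged and the sum is reindexed by
  \<open>i \<mapsto> i'\<close>, which turns them into \<open>- {g, \<partial>\<^sub>j f}\<close>. The second bracket is written in this order because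
  its first argument has to be even.
\<close>

lemma oder_poisson:
  fixes f g :: "'a oelt"
  assumes f: "f \<in> oeven" and g: "g \<in> oeven" and j: "j \<in> Y"
  shows "oder j (poisson f g) = poisson f (oder j g) - poisson g (oder j f)"
proof -
  have F: "f \<in> osuper" "f \<in> ohomog 0" and G: "g \<in> osuper" "g \<in> ohomog 0"
    using f g by (auto simp: oeven_def)
  have *: "oder j (omult (oder i f) (oder (conj_idx i) g))
      = omult (oder i f) (oder (conj_idx i) (oder j g))
        + oscale ((- 1) ^ mu i) (omult (oder (conj_idx i) g) (oder i (oder j f)))"
    if i: "i \<in> Y" for i
  proof -
    note i' = conj_idx_Y[OF i]
    have di: "oder i f \<in> osuper" "oder i f \<in> ohomog (mu i)"
      using oder_osuper[OF F(1) i] oder_ohomog[OF F i] by simp_all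
    have dg: "oder (conj_idx i) g \<in> osuper" "oder (conj_idx i) g \<in> ohomog (mu i)"
      using oder_osuper[OF G(1) i'] oder_ohomog[OF G i'] by (simp_all add: mu_conj_idx[OF i])
    have dji: "oder j (oder i f) \<in> osuper" "oder j (oder i f) \<in> ohomog (mu j + mu i)"
      using oder_osuper[OF di(1) j] oder_ohomog[OF di j] by simp_all
    have "even ((mu j + mu i) * mu i) = even (mu i * mu j + mu i)"
      by (auto simp: even_mult_iff)
    then have sgn: "(- 1 :: 'a) ^ ((mu j + mu i) * mu i) = (- 1) ^ (mu i * mu j) * (- 1) ^ mu i"
      by (simp add: minus_one_power_iff flip: power_add)
    have "omult (oder j (oder i f)) (oder (conj_idx i) g)
        = oscale ((- 1) ^ mu i) (omult (oder (conj_idx i) g) (oscale ((- 1) ^ (mu i * mu j)) (oder j (oder i f))))"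
      unfolding omult_supercommute[OF dji dg] sgn omult_scale_right by (simp add: mult.commute)
    also have "\<dots> = oscale ((- 1) ^ mu i) (omult (oder (conj_idx i) g) (oder i (oder j f)))"
      by (simp only: oder_commute[OF F(1) i j])
    finally have 1: "omult (oder j (oder i f)) (oder (conj_idx i) g)
      = oscale ((- 1) ^ mu i) (omult (oder (conj_idx i) g) (oder i (oder j f)))" .
    have "oscale ((- 1) ^ (mu j * mu i)) (oder j (oder (conj_idx i) g)) = oder (conj_idx i) (oder j g)"
      using oder_commute[OF G(1) i' j] by (simp add: mu_conj_idx[OF i] mult.commute)
    then show ?thesis
      using oder_omult[OF di dg(1) j] 1 by (simp flip: omult_scale_right)
  qed
  have "oder j (poisson f g) = (\<Sum>i\<in>Y. oscale (tau i) (oder j (omult (oder i f) (oder (conj_idx i) g))))"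
    by (simp add: poisson_def oder_sum oder_scale)
  also have "\<dots> = (\<Sum>i\<in>Y. oscale (tau i) (omult (oder i f) (oder (conj_idx i) (oder j g)))
      - oscale (tau (conj_idx i)) (omult (oder (conj_idx i) g) (oder (conj_idx (conj_idx i)) (oder j f))))"
  proof (intro sum.cong refl)
    fix i assume i: "i \<in> Y"
    have "tau i * (- 1) ^ mu i = - (tau (conj_idx i) :: 'a)"
      using tau_conj_idx[OF conj_idx_Y[OF i], where 'a = 'a]
      by (simp add: conj_idx_conj_idx[OF i] mu_conj_idx[OF i])
    then show "oscale (tau i) (oder j (omult (oder i f) (oder (conj_idx i) g)))
      = oscale (tau i) (omult (oder i f) (oder (conj_idx i) (oder j g)))
      - oscale (tau (conj_idx i)) (omult (oder (conj_idx i) g) (oder (conj_idx (conj_idx i)) (oder j f)))"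
      by (simp add: *[OF i] conj_idx_conj_idx[OF i] ospace.scale_right_distrib)
  qed
  also have "\<dots> = poisson f (oder j g) - poisson g (oder j f)"
    by (simp add: sum_subtractf poisson_def
        sum_conj_idx[of "\<lambda>i. oscale (tau i) (omult (oder i g) (oder (conj_idx i) (oder j f)))"])
  finally show ?thesis .
qed

text \<open>
  The components of \<open>[D_H f, D_H g]\<close> are \<open>\<plusminus> ({f, \<partial>\<^sub>j g} - {g, \<partial>\<^sub>j f})\<close>, so this is the Leibniz rule
  \<open>oder_poisson\<close> for the Poisson bracket.
\<close>

lemma wbr_DH:
  fixes f g :: "'a oelt"
  assumes f: "f \<in> oeven" and g: "g \<in> oeven"
  shows "wbr (DH f) (DH g) = DH (poisson f g)"
proof
  fix k
  show "wbr (DH f) (DH g) k = DH (poisson f g) k"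
    using conj_idx_Y[of k]
    by (simp add: wbr_even DH_even_witt f g DH_apply poisson_oeven wact_scale wact_DH oder_poisson
        ospace.scale_right_diff_distrib)
qed

text \<open>
  The coefficient of \<open>x^(\<pi>) x^w\<close> behaves like an integral over the even variables: it vanishes on
  derivatives \<open>\<partial>\<^sub>i h\<close> for even \<open>i\<close>. Integration by parts moves \<open>\<partial>\<^sub>i\<close> away from \<open>f\<close>; the remaining terms
  \<open>c i\<close>, the coefficients of \<open>f \<partial>\<^sub>i \<partial>\<^bsub>i'\<^esub> g\<close>, are symmetric under \<open>i \<mapsto> i'\<close> and cancel in pairs. For odd \<open>i\<close>
  and \<open>w = \<omega>\<close> the same integration by parts leaves \<open>f \<partial>\<^sub>i \<partial>\<^sub>i g = 0\<close>, and for odd \<open>i\<close> and empty \<open>w\<close> the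
  product \<open>\<partial>\<^sub>i f \<partial>\<^sub>i g\<close> does not contribute, as \<open>\<partial>\<^sub>i f\<close> is odd.
\<close>

lemma poisson_top_coeffs:
  fixes f g :: "'a oelt"
  assumes f: "f \<in> oeven" and g: "g \<in> oeven"
  shows "poisson f g (top_idx, Y1) = 0" "poisson f g (top_idx, {}) = 0"
proof -
  have F: "f \<in> osuper" "f \<in> ohomog 0" and G: "g \<in> osuper" using f g by (auto simp: oeven_def)
  have leibniz: "omult (oder i f) (oder (conj_idx i) g)
      = oder i (omult f (oder (conj_idx i) g)) - omult f (oder i (oder (conj_idx i) g))"
    if i: "i \<in> Y" for i
    using oder_omult[OF F oder_osuper[OF G conj_idx_Y[OF i]] i] by simp
  have even_part: "(\<Sum>i\<in>Y0. tau i * omult (oder i f) (oder (conj_idx i) g) (top_idx, w)) = 0" for w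
  proof -
    define c where "c i = omult f (oder i (oder (conj_idx i) g)) (top_idx, w)" for i
    have "omult (oder i f) (oder (conj_idx i) g) (top_idx, w) = - c i" if "i \<in> Y0" for i
      using that by (simp add: leibniz Y_def minus_apply oder_top_even c_def)
    moreover have "c (conj_idx i) = c i" if "i \<in> Y0" for i
      using oder_commute[OF G, of "conj_idx i" i] that
      by (simp add: c_def Y_def mu_Y0 conj_idx_conj_idx conj_idx_Y0)
    moreover have "{1..m} \<subseteq> Y0" by (auto simp: Y0_def)
    ultimately have "tau i * omult (oder i f) (oder (conj_idx i) g) (top_idx, w)
        + tau (conj_idx i) * omult (oder (conj_idx i) f) (oder (conj_idx (conj_idx i)) g) (top_idx, w) = 0"
      if "i \<in> {1..m}" for i
      using that tau_conj_idx[of i, where 'a = 'a] conj_idx_Y0[of i]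
      by (auto simp: Y_def mu_Y0 subset_iff)
    then show ?thesis unfolding sum_Y0_pairs by simp
  qed
  have split: "poisson f g (top_idx, w) = (\<Sum>i\<in>Y1. tau i * omult (oder i f) (oder i g) (top_idx, w))" for w
  proof -
    have "poisson f g (top_idx, w) = (\<Sum>i\<in>Y. tau i * omult (oder i f) (oder (conj_idx i) g) (top_idx, w))"
      by (simp add: poisson_def sum_oelt_apply oscale_apply)
    also have "\<dots> = (\<Sum>i\<in>Y1. tau i * omult (oder i f) (oder (conj_idx i) g) (top_idx, w))"
      unfolding Y_def using even_part[of w] Y0_disjoint_Y1 finite_Y by (simp add: sum.union_disjoint)
    finally show ?thesis by (simp add: conj_idx_Y1)
  qed
  have "omult (oder i f) (oder i g) (top_idx, Y1) = 0" if "i \<in> Y1" for i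
    using leibniz[of i] that
    by (simp add: Y_def conj_idx_Y1 oder_odd_square G omult_zero_right minus_apply oder_top_odd zero_fun_apply)
  then show "poisson f g (top_idx, Y1) = 0" by (simp add: split)
  have "omult (oder i f) (oder i g) (top_idx, {}) = 0" if "i \<in> Y1" for i
  proof (rule omult_odd_empty)
    have "i \<in> Y" using that by (simp add: Y_def)
    then show "oder i f \<in> osuper" "oder i g \<in> osuper" "oder i f \<in> ohomog 1"
      using F G oder_osuper oder_ohomog[OF F, of i] that by (simp_all add: mu_Y1)
  qed
  then show "poisson f g (top_idx, {}) = 0" by (simp add: split)
qed

section \<open>The ideal\<close>

text \<open>
  The coefficient of \<open>x^(\<pi>) x^\<omega>\<close> has to vanish for the bracket to stay in \<open>\<H>\<close> at all, and that of
  \<open>x^(\<pi>)\<close> for it to land in \<open>\<NN>\<close>.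
\<close>

lemma wbr_ham_even:
  fixes D E :: "'a welt"
  assumes "D \<in> ham_even" "E \<in> ham_even"
  shows "wbr D E \<in> ham_N"
proof -
  obtain f g :: "'a oelt" where "D = DH f" "E = DH g" "f \<in> oeven" "g \<in> oeven"
    using assms by (auto simp: ham_even_conv)
  then show ?thesis
    unfolding ham_N_conv using poisson_oeven poisson_top_coeffs by (simp add: wbr_DH)
qed

lemma lie_ideal_ham_N: "lie_ideal wscale (ham_even :: 'a welt set) wbr ham_N"
proof -
  have sub: "ham_N \<subseteq> (ham_even :: 'a welt set)" unfolding ham_N_conv ham_even_conv by blast
  have subspace: "wspace.subspace (ham_even :: 'a welt set)" "wspace.subspace (ham_N :: 'a welt set)"
    unfolding ham_even_def ham_N_def by (rule wspace.subspace_span)+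
  have "lie_algebra wscale (ham_even :: 'a welt set) wbr"
  proof (rule lie_algebra_subalgebra[OF lie_algebra_even_witt subspace(1)])
    show "(ham_even :: 'a welt set) \<subseteq> even_witt"
      unfolding ham_even_conv using DH_even_witt by blast
    show "wbr D E \<in> ham_even" if "D \<in> ham_even" "E \<in> ham_even" for D E :: "'a welt"
      using wbr_ham_even[OF that] sub by blast
  qed
  then show ?thesis
    unfolding lie_ideal_def lie_ideal_axioms_def
    using subspace(2) sub wbr_ham_even by blast
qed

end

theorem proposition2p1:
  fixes p m n :: nat and t :: "nat \<Rightarrow> nat"
  assumes "CHAR('a::field) = p" and "p > 3"
    and "m > 1" and "n > 3"
    and "\<And>i. i \<in> {1..2 * m} \<Longrightarrow> t i > 0"
  shows "lie_ideal (wscale :: 'a \<Rightarrow> 'a welt \<Rightarrow> 'a welt)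
    (superalgebra_params.ham_even p m n t)
    (superalgebra_params.wbr p m n t)
    (superalgebra_params.ham_N p m n t)"
proof -
  have "prime p" using assms(1,2) prime_CHAR_semidom[where 'a = 'a] by simp
  then interpret modular_superalgebra p m n t "TYPE('a)"
    by unfold_locales (rule assms(1))
  show ?thesis by (rule lie_ideal_ham_N)
qed

end
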